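(* Let $(V,\sigma)$ be a pre-braided vector space over a field $\Bbbk$. (1) For a braided character $\epsilon\in V^*$, the maps $V^{\otimes n}\to V^{\otimes(n-1)}$, $n\ge 1$, $${}^{\epsilon}d(\bar v)=\epsilon_1\circ \mathrm{csh}_{-\sigma}^{1,n-1}(\bar v),\qquad d^{\epsilon}(\bar v)=(-1)^{n-1}\,\epsilon_n\circ \mathrm{csh}_{-\sigma}^{n-1,1}(\bar v)$$ define a bidifferential on $T(V)$. (2) For two braided characters $\epsilon$ and $\zeta$, $(T(V),{}^{\epsilon}d,d^{\zeta})$ is a bicomplex. If moreover $\epsilon$ and $\zeta$ are $\sigma$-compatible, then $(T(V),{}^{\epsilon}d,{}^{\zeta}d)$ and $(T(V),d^{\epsilon},d^{\zeta})$ are bicomplexes.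
   Context: All tensor products are over $\Bbbk$. $T(V)=\bigoplus_{n\ge 0}V^{\otimes n}$ with $V^{\otimes 0}=\Bbbk$; the maps below are $0$ on $V^{\otimes 0}$. A pre-braiding on $V$ is a linear map $\sigma:V\otimes V\to V\otimes V$ (not necessarily invertible) with $\sigma_1\sigma_2\sigma_1=\sigma_2\sigma_1\sigma_2$ on $V^{\otimes 3}$, where for a linear map $\varphi:V^{\otimes l}\to V^{\otimes r}$, $\varphi_i$ denotes $\mathrm{Id}_{V^{\otimes(i-1)}}\otimes\varphi\otimes\mathrm{Id}$ (so $\varphi$ is applied starting from the $i$-th tensor factor); thus $\epsilon_1=\epsilon\otimes \mathrm{Id}_{V^{\otimes(n-1)}}$, $\epsilon_n=\mathrm{Id}_{V^{\otimes(n-1)}}\otimes\epsilon$ on $V^{\otimes n}$. If $\sigma$ is a pre-braiding, so is $-\sigma$. A pair $(V,\sigma)$ with $\sigma$ a pre-braiding is a pre-braided vector space. For a pre-braiding $\beta$ and $s\in S_n$, choose a shortest expression $s=\tau_{i_1}\cdots\tau_{i_k}$ in the adjacent transpositions $\tau_i=(i\ i{+}1)$ and put $T_s^{\beta}=\beta_{i_1}\circ\cdots\circ\beta_{i_k}\in\mathrm{End}(V^{\otimes n})$ (well defined by the Yang-Baxter equation). Let $Sh_{p,q}\subset S_{p+q}$ be the set of $s$ with $s(1)<\dots<s(p)$ and $s(p+1)<\dots<s(p+q)$. The quantum co-shuffle comultiplication has components $\mathrm{csh}_{\beta}^{p,q}=\sum_{s\in Sh_{p,q}}T^{\beta}_{s^{-1}}:V^{\otimes(p+q)}\to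 V^{\otimes p}\otimes V^{\otimes q}$. Two elements $f,g\in V^*$ are $\sigma$-compatible if $(f\otimes g)\circ\sigma=g\otimes f$ and $(g\otimes f)\circ\sigma=f\otimes g$. A braided character is $\epsilon\in V^*$ with $(\epsilon\otimes\epsilon)\circ\sigma=\epsilon\otimes\epsilon$. A differential on a graded space is a square-zero endomorphism of degree $\pm1$; a bidifferential is a pair of anticommuting differentials; a bicomplex is a graded space with a bidifferential. *)

theory Defs
  imports
    Complex_Main
    "HOL-Library.Function_Algebras"
    "HOL-Combinatorics.Permutations"
begin

section \<open>Graded spaces, differentials, bicomplexes\<close>

definition linear_on ::
  "('k::field \<Rightarrow> 'a::ab_group_add \<Rightarrow> 'a) \<Rightarrow> ('k \<Rightarrow> 'b::ab_group_add \<Rightarrow> 'b) \<Rightarrow> 'a set \<Rightarrow> ('a \<Rightarrow> 'b) \<Rightarrow> bool"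
  where "linear_on sa sb W f \<longleftrightarrow>
    (\<forall>x\<in>W. \<forall>y\<in>W. f (x + y) = f x + f y) \<and> (\<forall>c. \<forall>x\<in>W. f (sa c x) = sb c (f x))"

text \<open>Gradings are indexed by the integers, so that an endomorphism of degree \<open>-1\<close> of a space
  graded by the naturals kills the component of degree 0.\<close>

definition graded_space ::
  "('k::field \<Rightarrow> 'a::ab_group_add \<Rightarrow> 'a) \<Rightarrow> 'a set \<Rightarrow> (int \<Rightarrow> 'a set) \<Rightarrow> bool"
  where "graded_space s W G \<longleftrightarrow> vector_space s \<and>
    (\<forall>k. Modules.module.subspace s (G k)) \<and>
    W = Modules.module.span s (\<Union>k. G k) \<and>
    (\<forall>K x. finite K \<and> (\<forall>k\<in>K. x k \<in> G k) \<and> (\<Sum>k\<in>K. x k) = 0 \<longrightarrow> (\<forall>k\<in>K. x k = 0))"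

definition endo_of_degree ::
  "('k::field \<Rightarrow> 'a::ab_group_add \<Rightarrow> 'a) \<Rightarrow> 'a set \<Rightarrow> (int \<Rightarrow> 'a set) \<Rightarrow> int \<Rightarrow> ('a \<Rightarrow> 'a) \<Rightarrow> bool"
  where "endo_of_degree s W G e d \<longleftrightarrow>
    linear_on s s W d \<and> d ` W \<subseteq> W \<and> (\<forall>k. d ` G k \<subseteq> G (k + e))"

definition differential ::
  "('k::field \<Rightarrow> 'a::ab_group_add \<Rightarrow> 'a) \<Rightarrow> 'a set \<Rightarrow> (int \<Rightarrow> 'a set) \<Rightarrow> ('a \<Rightarrow> 'a) \<Rightarrow> bool"
  where "differential s W G d \<longleftrightarrow>
    (endo_of_degree s W G 1 d \<or> endo_of_degree s W G (-1) d) \<and> (\<forall>x\<in>W. d (d x) = 0)"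

definition bidifferential ::
  "('k::field \<Rightarrow> 'a::ab_group_add \<Rightarrow> 'a) \<Rightarrow> 'a set \<Rightarrow> (int \<Rightarrow> 'a set) \<Rightarrow> ('a \<Rightarrow> 'a) \<Rightarrow> ('a \<Rightarrow> 'a) \<Rightarrow> bool"
  where "bidifferential s W G d d' \<longleftrightarrow>
    differential s W G d \<and> differential s W G d' \<and> (\<forall>x\<in>W. d (d' x) + d' (d x) = 0)"

definition bicomplex ::
  "('k::field \<Rightarrow> 'a::ab_group_add \<Rightarrow> 'a) \<Rightarrow> 'a set \<Rightarrow> (int \<Rightarrow> 'a set) \<Rightarrow> ('a \<Rightarrow> 'a) \<Rightarrow> ('a \<Rightarrow> 'a) \<Rightarrow> bool"
  where "bicomplex s W G d d' \<longleftrightarrow> graded_space s W G \<and> bidifferential s W G d d'"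


section \<open>Tensor powers and the tensor algebra\<close>

text \<open>The vector space \<open>V\<close> is the whole type \<open>'v\<close> with scalar multiplication \<open>s\<close>. A
  function on lists is multilinear if for each \<open>n\<close> its restriction to lists of length \<open>n\<close> is
  \<open>n\<close>-linear, so it is a family of one \<open>n\<close>-linear map for each \<open>n\<close>.\<close>

definition multilinear ::
  "('k::field \<Rightarrow> 'v::ab_group_add \<Rightarrow> 'v) \<Rightarrow> ('k \<Rightarrow> 'w::ab_group_add \<Rightarrow> 'w) \<Rightarrow> ('v list \<Rightarrow> 'w) \<Rightarrow> bool"
  where "multilinear s sw m \<longleftrightarrow> (\<forall>us ws. Vector_Spaces.linear s sw (\<lambda>v. m (us @ v # ws)))"

text \<open>We realise the decomposable tensor \<open>v\<^sub>1 \<otimes> \<dots> \<otimes> v\<^sub>n\<close> as the evaluation functional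
  \<open>A \<mapsto> A(v\<^sub>1, \<dots>, v\<^sub>n)\<close> on multilinear forms, and the tensor algebra as the span of all decomposable
  tensors. Lemma \<open>tensor_algebra_universal\<close> below is the universal property.\<close>

type_synonym ('k, 'v) tensor = "('v list \<Rightarrow> 'k) \<Rightarrow> 'k"

definition tensor_scale :: "'k::field \<Rightarrow> ('k, 'v) tensor \<Rightarrow> ('k, 'v) tensor"
  where "tensor_scale c t = (\<lambda>A. c * t A)"

interpretation tensor: vector_space tensor_scale
  by unfold_locales (auto simp: tensor_scale_def fun_eq_iff algebra_simps)

definition tensor_of :: "('k::field \<Rightarrow> 'v::ab_group_add \<Rightarrow> 'v) \<Rightarrow> 'v list \<Rightarrow> ('k, 'v) tensor"
  where "tensor_of s vs = (\<lambda>A. if multilinear s (*) A then A vs else 0)"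

definition tensor_algebra :: "('k::field \<Rightarrow> 'v::ab_group_add \<Rightarrow> 'v) \<Rightarrow> ('k, 'v) tensor set"
  where "tensor_algebra s = tensor.span (range (tensor_of s))"

definition tensor_power :: "('k::field \<Rightarrow> 'v::ab_group_add \<Rightarrow> 'v) \<Rightarrow> nat \<Rightarrow> ('k, 'v) tensor set"
  where "tensor_power s n = tensor.span (tensor_of s ` {vs. length vs = n})"

definition tensor_grading :: "('k::field \<Rightarrow> 'v::ab_group_add \<Rightarrow> 'v) \<Rightarrow> int \<Rightarrow> ('k, 'v) tensor set"
  where "tensor_grading s k = (if k < 0 then {0} else tensor_power s (nat k))"

text \<open>The linear map on the tensor algebra which sends \<open>v\<^sub>1 \<otimes> \<dots> \<otimes> v\<^sub>n\<close> to \<open>m [v\<^sub>1, \<dots>, v\<^sub>n]\<close>, for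
  multilinear tensor-valued \<open>m\<close>: see lemmas \<open>linear_on_tensor_lift\<close> and
  \<open>tensor_lift_tensor_of\<close> below.\<close>

definition tensor_lift :: "('v list \<Rightarrow> ('k, 'v) tensor) \<Rightarrow> ('k, 'v) tensor \<Rightarrow> ('k, 'v) tensor"
  where "tensor_lift m t = (\<lambda>A. t (\<lambda>vs. m vs A))"

definition tensor_prod ::
  "('k::field \<Rightarrow> 'v::ab_group_add \<Rightarrow> 'v) \<Rightarrow> ('k, 'v) tensor \<Rightarrow> ('k, 'v) tensor \<Rightarrow> ('k, 'v) tensor"
  where "tensor_prod s x y = tensor_lift (\<lambda>us. tensor_lift (\<lambda>ws. tensor_of s (us @ ws)) y) x"

text \<open>\<open>apply_at s l i \<phi>\<close> is the map \<open>\<phi>\<^sub>i = Id \<otimes> \<phi> \<otimes> Id\<close> for \<open>\<phi>\<close> defined on the \<open>l\<close>-th tensor power and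
  \<open>i \<ge> 1\<close>, extended by \<open>0\<close> to the tensor powers of exponent less than \<open>i - 1 + l\<close>.\<close>

definition apply_at ::
  "('k::field \<Rightarrow> 'v::ab_group_add \<Rightarrow> 'v) \<Rightarrow> nat \<Rightarrow> nat \<Rightarrow> (('k, 'v) tensor \<Rightarrow> ('k, 'v) tensor) \<Rightarrow>
    ('k, 'v) tensor \<Rightarrow> ('k, 'v) tensor"
  where "apply_at s l i \<phi> = tensor_lift (\<lambda>vs.
    if i - 1 + l \<le> length vs
    then tensor_prod s (tensor_of s (take (i - 1) vs))
           (tensor_prod s (\<phi> (tensor_of s (take l (drop (i - 1) vs))))
             (tensor_of s (drop (i - 1 + l) vs)))
    else 0)"

lemma vector_space_field: "vector_space ((*) :: 'k::field \<Rightarrow> 'k \<Rightarrow> 'k)"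
  by unfold_locales (auto simp: algebra_simps)

lemma multilinear_tensor_of:
  assumes "vector_space s"
  shows "multilinear s tensor_scale (tensor_of s)"
proof -
  have "Vector_Spaces.linear s tensor_scale (\<lambda>v. tensor_of s (us @ v # ws))" for us ws
  proof -
    have "multilinear s (*) A \<Longrightarrow> Vector_Spaces.linear s (*) (\<lambda>v. A (us @ v # ws))" for A :: "'b list \<Rightarrow> 'a"
      by (simp add: multilinear_def)
    then show ?thesis
      using assms
      by (auto simp: Vector_Spaces.linear_iff tensor.vector_space_axioms tensor_of_def
          tensor_scale_def fun_eq_iff)
  qed
  then show ?thesis by (simp add: multilinear_def)
qed

lemma tensor_algebra_zero:
  assumes "t \<in> tensor_algebra s" and "\<not> multilinear s (*) A"
  shows "t A = 0"
  using assms unfolding tensor_algebra_def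
  by (induction rule: tensor.span_induct_alt) (auto simp: tensor_of_def tensor_scale_def)

lemma linear_on_tensor_lift: "linear_on tensor_scale tensor_scale W (tensor_lift m)"
  by (auto simp: linear_on_def tensor_lift_def tensor_scale_def)

lemma tensor_lift_tensor_of:
  assumes m: "multilinear s tensor_scale m"
  shows "tensor_lift m (tensor_of s vs) = m vs"
proof
  fix A :: "'b list \<Rightarrow> 'a"
  have "multilinear s (*) (\<lambda>vs. m vs A)"
    using m by (auto simp: multilinear_def Vector_Spaces.linear_iff vector_space_field tensor_scale_def)
  then show "tensor_lift m (tensor_of s vs) A = m vs A"
    by (simp add: tensor_lift_def tensor_of_def)
qed

lemma functional_nonzero:
  assumes "vector_space sw" "w \<noteq> 0"
  obtains f where "Vector_Spaces.linear sw ((*) :: 'k::field \<Rightarrow> 'k \<Rightarrow> 'k) f" "f w \<noteq> 0"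
proof -
  interpret p: vector_space_pair sw "(*) :: 'k \<Rightarrow> 'k \<Rightarrow> 'k"
    using assms(1) vector_space_field by (simp add: vector_space_pair_def)
  have "p.vs1.independent {w}" using assms(2) by simp
  from p.linear_independent_extend[OF this, of "\<lambda>_. 1"] show ?thesis
    using that by (metis singletonI zero_neq_one)
qed

text \<open>Universal property: multilinear maps extend to linear maps on the tensor algebra (uniquely,
  since decomposable tensors span by definition).\<close>

lemma tensor_algebra_universal:
  fixes s :: "'k::field \<Rightarrow> 'v::ab_group_add \<Rightarrow> 'v"
    and sw :: "'k \<Rightarrow> 'w::ab_group_add \<Rightarrow> 'w"
  assumes m: "multilinear s sw m"
  shows "\<exists>h. linear_on tensor_scale sw (tensor_algebra s) h \<and> (\<forall>vs. h (tensor_of s vs) = m vs)"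
proof -
  have sw: "vector_space sw"
    using m by (auto simp: multilinear_def Vector_Spaces.linear_iff)
  interpret W: vector_space sw by (rule sw)
  interpret p: vector_space_pair "tensor_scale :: 'k \<Rightarrow> ('k, 'v) tensor \<Rightarrow> _" sw
    by (simp add: vector_space_pair_def sw tensor.vector_space_axioms)
  let ?P = "range (tensor_of s)"
  have comp: "multilinear s (*) (\<lambda>vs. f (m vs))" if "Vector_Spaces.linear sw (*) f" for f
    using m that by (auto simp: multilinear_def Vector_Spaces.linear_iff)
  have key: "m vs = (\<Sum>b\<in>S. sw (r b) (m (g b)))"
    if "tensor_of s vs = (\<Sum>b\<in>S. tensor_scale (r b) (tensor_of s (g b)))" for vs g r and S :: "('k, 'v) tensor set"
  proof (rule ccontr)
    assume "\<not> ?thesis"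
    then have "m vs - (\<Sum>b\<in>S. sw (r b) (m (g b))) \<noteq> 0" by simp
    then obtain f where f: "Vector_Spaces.linear sw ((*) :: 'k \<Rightarrow> _) f"
      "f (m vs - (\<Sum>b\<in>S. sw (r b) (m (g b)))) \<noteq> 0"
      using functional_nonzero[OF sw] by blast
    interpret f: Vector_Spaces.linear sw "(*)" f by (rule f(1))
    have "(\<Sum>b\<in>S. tensor_scale (r b) (tensor_of s (g b))) (\<lambda>vs. f (m vs)) =
        (\<Sum>b\<in>S. r b * f (m (g b)))"
      by (induction S rule: infinite_finite_induct)
        (auto simp: tensor_scale_def tensor_of_def comp[OF f(1)])
    moreover have "tensor_of s vs (\<lambda>vs. f (m vs)) = f (m vs)"
      by (simp add: tensor_of_def comp[OF f(1)])
    ultimately have "f (m vs) = (\<Sum>b\<in>S. r b * f (m (g b)))" using that by metis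
    then show False using f(2) by (simp add: f.diff f.sum f.scale)
  qed
  obtain B where B: "B \<subseteq> ?P" "tensor.independent B" "?P \<subseteq> tensor.span B"
    using tensor.maximal_independent_subset[of ?P] by blast
  define g where "g b = (SOME vs. tensor_of s vs = b)" for b
  have g: "tensor_of s (g b) = b" if "b \<in> B" for b
  proof -
    have "\<exists>vs. tensor_of s vs = b" using B(1) that by blast
    then show ?thesis unfolding g_def by (rule someI_ex)
  qed
  obtain h where h: "Vector_Spaces.linear tensor_scale sw h" "\<forall>b\<in>B. h b = m (g b)"
    using p.linear_independent_extend[OF B(2), of "\<lambda>b. m (g b)"] by blast
  interpret h: Vector_Spaces.linear tensor_scale sw h by (rule h(1))
  have "h (tensor_of s vs) = m vs" for vs
  proof -
    have "tensor_of s vs \<in> tensor.span B" using B(3) by blast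
    then obtain S r where S: "finite S" "S \<subseteq> B" "tensor_of s vs = (\<Sum>b\<in>S. tensor_scale (r b) b)"
      unfolding tensor.span_explicit by auto
    have eq: "(\<Sum>b\<in>S. tensor_scale (r b) b) = (\<Sum>b\<in>S. tensor_scale (r b) (tensor_of s (g b)))"
      using S(2) g by (intro sum.cong) auto
    have "m vs = (\<Sum>b\<in>S. sw (r b) (m (g b)))" by (rule key[OF trans[OF S(3) eq]])
    also have "\<dots> = h (tensor_of s vs)"
      unfolding S(3) h.sum h.scale using S(2) h(2) by (intro sum.cong) auto
    finally show ?thesis by simp
  qed
  moreover have "linear_on tensor_scale sw (tensor_algebra s) h"
    by (auto simp: linear_on_def h.add h.scale)
  ultimately show ?thesis by blast
qed

lemma tensor_of_in_algebra [simp]: "tensor_of s vs \<in> tensor_algebra s"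
  by (simp add: tensor_algebra_def tensor.span_base)

lemma tensor_lift_add: "tensor_lift m (x + y) = tensor_lift m x + tensor_lift m y"
  by (auto simp: tensor_lift_def)

lemma tensor_lift_scale: "tensor_lift m (tensor_scale c x) = tensor_scale c (tensor_lift m x)"
  by (auto simp: tensor_lift_def tensor_scale_def)

lemma tensor_lift_zero [simp]: "tensor_lift m 0 = 0"
  by (auto simp: tensor_lift_def)

lemma multilinear_zero: "vector_space s \<Longrightarrow> vector_space sw \<Longrightarrow> multilinear s sw (\<lambda>_. 0)"
  by (simp add: multilinear_def Vector_Spaces.linear_iff module.scale_zero_right module_iff_vector_space)

lemma multilinear_scale_add:
  assumes f: "multilinear s sw f" and g: "multilinear s sw g"
  shows "multilinear s sw (\<lambda>us. sw c (f us) + g us)"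
  unfolding multilinear_def
proof (intro allI)
  fix us ws
  interpret f: Vector_Spaces.linear s sw "\<lambda>v. f (us @ v # ws)"
    using f by (simp add: multilinear_def)
  interpret g: Vector_Spaces.linear s sw "\<lambda>v. g (us @ v # ws)"
    using g by (simp add: multilinear_def)
  show "Vector_Spaces.linear s sw (\<lambda>v. sw c (f (us @ v # ws)) + g (us @ v # ws))"
    by unfold_locales
      (simp_all add: f.add g.add f.scale g.scale f.vs2.scale_right_distrib
        f.vs2.scale_left_commute add_ac del: f.vs2.scale_scale)
qed

lemma linear_on_zero: "vector_space sb \<Longrightarrow> linear_on sa sb W (\<lambda>_. 0)"
  by (simp add: linear_on_def module.scale_zero_right module_iff_vector_space)

lemma multilinear_append:
  assumes "multilinear s sw m"
  shows "multilinear s sw (\<lambda>ws. m (us @ ws))" "multilinear s sw (\<lambda>us. m (us @ ws))"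
  unfolding multilinear_def
proof (intro allI)
  show "Vector_Spaces.linear s sw (\<lambda>v. m (us @ xs @ v # ys))" for xs ys
    using assms[unfolded multilinear_def, rule_format, of "us @ xs" ys] by simp
  show "\<forall>xs ys. Vector_Spaces.linear s sw (\<lambda>v. m ((xs @ v # ys) @ ws))"
    using assms[unfolded multilinear_def, rule_format, of _ "_ @ ws"] by simp
qed

lemma tensor_algebra_zero_mem: "0 \<in> tensor_algebra s"
  and tensor_algebra_add: "x \<in> tensor_algebra s \<Longrightarrow> y \<in> tensor_algebra s \<Longrightarrow> x + y \<in> tensor_algebra s"
  and tensor_algebra_scale: "x \<in> tensor_algebra s \<Longrightarrow> tensor_scale c x \<in> tensor_algebra s"
  unfolding tensor_algebra_def by (rule tensor.span_zero tensor.span_add tensor.span_scale; assumption)+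

lemma tensor_algebra_induct:
  assumes "t \<in> tensor_algebra s" and "P 0"
    and "\<And>c vs t. t \<in> tensor_algebra s \<Longrightarrow> P t \<Longrightarrow> P (tensor_scale c (tensor_of s vs) + t)"
  shows "P t"
proof -
  have "t \<in> tensor_algebra s \<and> P t"
  proof (rule tensor.span_induct_alt[OF assms(1)[unfolded tensor_algebra_def]])
    show "0 \<in> tensor_algebra s \<and> P 0"
      using tensor_algebra_zero_mem assms(2) by (rule conjI)
    fix c x y
    assume "x \<in> range (tensor_of s)" and y: "y \<in> tensor_algebra s \<and> P y"
    then obtain vs where x: "x = tensor_of s vs" by blast
    have "tensor_scale c x + y \<in> tensor_algebra s"
      using y unfolding x by (intro tensor_algebra_add tensor_algebra_scale tensor_of_in_algebra) blast
    then show "tensor_scale c x + y \<in> tensor_algebra s \<and> P (tensor_scale c x + y)"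
      using assms(3) y by (simp only: x simp_thms)
  qed
  then show ?thesis ..
qed

lemma tensor_lift_append:
  assumes "vector_space s" "y \<in> tensor_algebra s"
  shows "multilinear s tensor_scale (\<lambda>us. tensor_lift (\<lambda>ws. tensor_of s (us @ ws)) y) \<and>
    (\<forall>us. tensor_lift (\<lambda>ws. tensor_of s (us @ ws)) y \<in> tensor_algebra s)"
proof -
  define Q where "Q y \<longleftrightarrow>
    multilinear s tensor_scale (\<lambda>us. tensor_lift (\<lambda>ws. tensor_of s (us @ ws)) y) \<and>
    (\<forall>us. tensor_lift (\<lambda>ws. tensor_of s (us @ ws)) y \<in> tensor_algebra s)" for y
  have "Q 0"
    unfolding Q_def tensor_lift_zero
    by (rule conjI[OF multilinear_zero[OF assms(1) tensor.vector_space_axioms]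
          allI[OF tensor_algebra_zero_mem]])
  moreover have "Q (tensor_scale c (tensor_of s vs) + t)" if Q: "Q t" for c vs t
  proof -
    note P = Q[unfolded Q_def]
    have m: "multilinear s tensor_scale (tensor_of s)"
      by (rule multilinear_tensor_of[OF assms(1)])
    have "tensor_lift (\<lambda>ws. tensor_of s (us @ ws)) (tensor_of s vs) = tensor_of s (us @ vs)" for us
      by (rule tensor_lift_tensor_of[OF multilinear_append(1)[OF m]])
    then have eq: "tensor_lift (\<lambda>ws. tensor_of s (us @ ws)) (tensor_scale c (tensor_of s vs) + t) =
        tensor_scale c (tensor_of s (us @ vs)) + tensor_lift (\<lambda>ws. tensor_of s (us @ ws)) t" for us
      by (simp add: tensor_lift_add tensor_lift_scale)
    have "multilinear s tensor_scale
        (\<lambda>us. tensor_lift (\<lambda>ws. tensor_of s (us @ ws)) (tensor_scale c (tensor_of s vs) + t))"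
      by (subst eq, rule multilinear_scale_add[OF multilinear_append(2)[OF m] conjunct1[OF P]])
    moreover have "\<forall>us. tensor_lift (\<lambda>ws. tensor_of s (us @ ws))
        (tensor_scale c (tensor_of s vs) + t) \<in> tensor_algebra s"
      by (rule allI, subst eq, rule tensor_algebra_add[OF tensor_algebra_scale[OF tensor_of_in_algebra]
            conjunct2[OF P, rule_format]])
    ultimately show ?thesis unfolding Q_def by (rule conjI)
  qed
  ultimately have "Q y"
    by (rule tensor_algebra_induct[OF assms(2)])
  then show ?thesis unfolding Q_def .
qed

lemma tensor_prod_tensor_of_left:
  assumes "vector_space s" "y \<in> tensor_algebra s"
  shows "tensor_prod s (tensor_of s us) y = tensor_lift (\<lambda>ws. tensor_of s (us @ ws)) y"
  unfolding tensor_prod_def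
  by (rule tensor_lift_tensor_of[OF conjunct1[OF tensor_lift_append[OF assms]]])

lemma tensor_prod_tensor_of:
  assumes "vector_space s"
  shows "tensor_prod s (tensor_of s us) (tensor_of s ws) = tensor_of s (us @ ws)"
  using tensor_lift_tensor_of[OF multilinear_append(1)[OF multilinear_tensor_of[OF assms]], of us ws]
  by (simp add: tensor_prod_tensor_of_left[OF assms])

lemma tensor_prod_left_linear:
  "Vector_Spaces.linear tensor_scale tensor_scale (\<lambda>x. tensor_prod s x y)"
  by (simp add: Vector_Spaces.linear_iff tensor.vector_space_axioms tensor_prod_def
      tensor_lift_add tensor_lift_scale)

lemma tensor_prod_in_algebra:
  assumes "vector_space s" "x \<in> tensor_algebra s" "y \<in> tensor_algebra s"
  shows "tensor_prod s x y \<in> tensor_algebra s"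
proof -
  define Q where "Q x \<longleftrightarrow> tensor_prod s x y \<in> tensor_algebra s" for x
  have "Q 0"
    by (simp only: Q_def tensor_prod_def tensor_lift_zero tensor_algebra_zero_mem)
  moreover have "Q (tensor_scale c (tensor_of s vs) + t)" if "Q t" for c vs t
  proof -
    have "tensor_prod s (tensor_of s vs) y \<in> tensor_algebra s"
      unfolding tensor_prod_tensor_of_left[OF assms(1,3)]
      by (rule conjunct2[OF tensor_lift_append[OF assms(1,3)], rule_format])
    moreover have "tensor_prod s (tensor_scale c (tensor_of s vs) + t) y =
        tensor_scale c (tensor_prod s (tensor_of s vs) y) + tensor_prod s t y"
      by (simp add: tensor_prod_def tensor_lift_add tensor_lift_scale)
    ultimately show ?thesis
      using that by (simp only: Q_def tensor_algebra_add tensor_algebra_scale)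
  qed
  ultimately have "Q x"
    by (rule tensor_algebra_induct[OF assms(2)])
  then show ?thesis unfolding Q_def .
qed

lemma tensor_prod_right_linear:
  assumes "vector_space s" "x \<in> tensor_algebra s"
  shows "linear_on tensor_scale tensor_scale (tensor_algebra s) (tensor_prod s x)"
proof -
  define Q where "Q x \<longleftrightarrow>
    linear_on tensor_scale tensor_scale (tensor_algebra s) (tensor_prod s x)" for x
  have "tensor_prod s 0 = (\<lambda>_. 0)"
    by (rule ext) (simp only: tensor_prod_def tensor_lift_zero)
  then have "Q 0"
    by (simp only: Q_def linear_on_zero[OF tensor.vector_space_axioms])
  moreover have "Q (tensor_scale c (tensor_of s vs) + t)" if Q: "Q t" for c vs t
  proof -
    define u where "u = tensor_scale c (tensor_of s vs) + t"
    have u: "tensor_prod s u y =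
        tensor_scale c (tensor_lift (\<lambda>ws. tensor_of s (vs @ ws)) y) + tensor_prod s t y"
      if "y \<in> tensor_algebra s" for y
      using tensor_prod_tensor_of_left[OF assms(1) that]
      by (simp add: u_def tensor_prod_def tensor_lift_add tensor_lift_scale)
    have "Q u"
      using Q by (simp add: Q_def linear_on_def u tensor_algebra_add tensor_algebra_scale
          tensor_lift_add tensor_lift_scale tensor.scale_right_distrib tensor.scale_left_commute add_ac)
    then show ?thesis by (simp only: u_def)
  qed
  ultimately have "Q x"
    by (rule tensor_algebra_induct[OF assms(2)])
  then show ?thesis unfolding Q_def .
qed

lemma multilinear_decompose:
  assumes "vector_space sw"
    and "\<And>us ws. \<lbrakk>i + l \<le> Suc (length us + length ws)\<rbrakk> \<Longrightarrow> Vector_Spaces.linear s sw (\<lambda>v. m (us @ v # ws))"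
    and "vector_space s" and "\<And>vs. length vs < i + l \<Longrightarrow> m vs = 0"
  shows "multilinear s sw m"
  unfolding multilinear_def
proof (intro allI)
  fix us ws
  interpret W: vector_space sw by (rule assms(1))
  show "Vector_Spaces.linear s sw (\<lambda>v. m (us @ v # ws))"
    using assms
    by (cases "i + l \<le> Suc (length us + length ws)") (auto simp: Vector_Spaces.linear_iff)
qed

text \<open>The defining property of \<open>\<phi>\<^sub>i\<close>.\<close>

lemma apply_at_tensor_of:
  assumes s: "vector_space s"
    and lin: "linear_on tensor_scale tensor_scale (tensor_power s l) \<phi>"
    and im: "\<phi> ` tensor_power s l \<subseteq> tensor_algebra s"
    and len: "length us = i - 1" "length xs = l"
  shows "apply_at s l i \<phi> (tensor_of s (us @ xs @ ws)) =
    tensor_prod s (tensor_of s us) (tensor_prod s (\<phi> (tensor_of s xs)) (tensor_of s ws))"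
proof -
  define j where "j = i - 1"
  define m where "m vs = (if j + l \<le> length vs
    then tensor_prod s (tensor_of s (take j vs))
           (tensor_prod s (\<phi> (tensor_of s (take l (drop j vs)))) (tensor_of s (drop (j + l) vs)))
    else 0)" for vs
  note T = multilinear_tensor_of[OF s]
  have P: "tensor_of s vs \<in> tensor_power s l" if "length vs = l" for vs
    using that by (auto simp: tensor_power_def intro: tensor.span_base)
  have \<phi>: "\<phi> (tensor_of s vs) \<in> tensor_algebra s" if "length vs = l" for vs
    using im P[OF that] by blast
  have T1: "tensor_of s (us @ (v + v') # ws) = tensor_of s (us @ v # ws) + tensor_of s (us @ v' # ws)"
    and T2: "tensor_of s (us @ s c v # ws) = tensor_scale c (tensor_of s (us @ v # ws))" for us ws v v' c
    using T by (auto simp: multilinear_def Vector_Spaces.linear_iff)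
  have R1: "tensor_prod s x (y + z) = tensor_prod s x y + tensor_prod s x z"
    and R2: "tensor_prod s x (tensor_scale c y) = tensor_scale c (tensor_prod s x y)"
    if "x \<in> tensor_algebra s" "y \<in> tensor_algebra s" "z \<in> tensor_algebra s" for x y z c
    using tensor_prod_right_linear[OF s that(1)] that by (auto simp: linear_on_def)
  have L1: "tensor_prod s (x + y) z = tensor_prod s x z + tensor_prod s y z"
    and L2: "tensor_prod s (tensor_scale c x) z = tensor_scale c (tensor_prod s x z)" for x y z c
    using tensor_prod_left_linear[of s z] by (auto simp: Vector_Spaces.linear_iff)
  have F1: "\<phi> (tensor_of s (us @ (v + v') # ws)) = \<phi> (tensor_of s (us @ v # ws)) + \<phi> (tensor_of s (us @ v' # ws))"
    and F2: "\<phi> (tensor_of s (us @ s c v # ws)) = tensor_scale c (\<phi> (tensor_of s (us @ v # ws)))"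
    if "Suc (length us + length ws) = l" for us ws v v' c
    using lin P[of "us @ v # ws"] P[of "us @ v' # ws"] that by (auto simp: linear_on_def T1 T2)
  note PA = tensor_prod_in_algebra[OF s]
  have "multilinear s tensor_scale m"
  proof (rule multilinear_decompose[where i = j and l = l])
    show "vector_space (tensor_scale :: 'a \<Rightarrow> ('a, 'b) tensor \<Rightarrow> _)" by (rule tensor.vector_space_axioms)
    show "vector_space s" by (rule s)
    show "m vs = 0" if "length vs < j + l" for vs using that by (simp add: m_def)
    fix us ws :: "'b list" assume le: "j + l \<le> Suc (length us + length ws)"
    consider "length us < j" | "j \<le> length us" "length us < j + l" | "j + l \<le> length us" by linarith
    then show "Vector_Spaces.linear s tensor_scale (\<lambda>v. m (us @ v # ws))"
    proof cases
      case 1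
      obtain d where d: "j = length us + Suc d" using 1 less_iff_Suc_add by (metis add_Suc_right)
      have "m (us @ v # ws) = tensor_prod s (tensor_of s (us @ v # take d ws))
          (tensor_prod s (\<phi> (tensor_of s (take l (drop d ws)))) (tensor_of s (drop (d + l) ws)))" for v
        using le by (simp add: m_def d)
      then show ?thesis
        using s tensor.vector_space_axioms by (simp add: Vector_Spaces.linear_iff T1 T2 L1 L2)
    next
      case 2
      obtain d where d: "j + l = length us + Suc d" using 2 less_iff_Suc_add by (metis add_Suc_right)
      define us' where "us' = drop j us"
      have l: "Suc (length us' + length (take d ws)) = l" using le 2 d by (simp add: us'_def)
      have "m (us @ v # ws) = tensor_prod s (tensor_of s (take j us))
          (tensor_prod s (\<phi> (tensor_of s (us' @ v # take d ws))) (tensor_of s (drop d ws)))" for v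
      proof -
        have "l - length us' = Suc d" using d 2 by (simp add: us'_def)
        moreover have "length us' \<le> l" using l by simp
        ultimately have "take l (us' @ v # ws) = us' @ v # take d ws"
          by simp
        then show ?thesis using le 2 d by (simp add: m_def us'_def)
      qed
      moreover have "\<phi> (tensor_of s (us' @ v # take d ws)) \<in> tensor_algebra s" for v
        using l by (intro \<phi>) simp
      ultimately show ?thesis
        using s tensor.vector_space_axioms
        by (simp add: Vector_Spaces.linear_iff F1[OF l] F2[OF l] L1 L2 R1 R2[OF _ _ tensor_of_in_algebra] PA)
    next
      case 3
      have "m (us @ v # ws) = tensor_prod s (tensor_of s (take j us))
          (tensor_prod s (\<phi> (tensor_of s (take l (drop j us)))) (tensor_of s (drop (j + l) us @ v # ws)))" for v
        using le 3 by (simp add: m_def)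
      moreover have "\<phi> (tensor_of s (take l (drop j us))) \<in> tensor_algebra s"
        using 3 by (intro \<phi>) simp
      ultimately show ?thesis
        using s tensor.vector_space_axioms
        by (simp add: Vector_Spaces.linear_iff T1 T2 R1 R2[OF _ _ tensor_of_in_algebra] PA)
    qed
  qed
  then have "tensor_lift m (tensor_of s (us @ xs @ ws)) = m (us @ xs @ ws)"
    by (rule tensor_lift_tensor_of)
  moreover have "apply_at s l i \<phi> = tensor_lift m"
    by (simp only: apply_at_def m_def[abs_def] j_def)
  ultimately show ?thesis using len by (simp add: m_def j_def)
qed


section \<open>Pre-braidings and braided characters\<close>

definition pre_braiding ::
  "('k::field \<Rightarrow> 'v::ab_group_add \<Rightarrow> 'v) \<Rightarrow> (('k, 'v) tensor \<Rightarrow> ('k, 'v) tensor) \<Rightarrow> bool"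
  where "pre_braiding s \<sigma> \<longleftrightarrow>
    linear_on tensor_scale tensor_scale (tensor_power s 2) \<sigma> \<and>
    \<sigma> ` tensor_power s 2 \<subseteq> tensor_power s 2 \<and>
    (\<forall>t\<in>tensor_power s 3.
      apply_at s 2 1 \<sigma> (apply_at s 2 2 \<sigma> (apply_at s 2 1 \<sigma> t)) =
      apply_at s 2 2 \<sigma> (apply_at s 2 1 \<sigma> (apply_at s 2 2 \<sigma> t)))"

text \<open>The value \<open>(f \<otimes> g)(t)\<close> for \<open>t\<close> in the second tensor power: a tensor is evaluated at the
  bilinear form \<open>(v, w) \<mapsto> f v * g w\<close>.\<close>

definition form_tensor ::
  "('v \<Rightarrow> 'k::field) \<Rightarrow> ('v \<Rightarrow> 'k) \<Rightarrow> ('k, 'v) tensor \<Rightarrow> 'k"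
  where "form_tensor f g t = t (\<lambda>vs. if length vs = 2 then f (vs ! 0) * g (vs ! 1) else 0)"

definition compatible ::
  "('k::field \<Rightarrow> 'v::ab_group_add \<Rightarrow> 'v) \<Rightarrow> (('k, 'v) tensor \<Rightarrow> ('k, 'v) tensor) \<Rightarrow>
    ('v \<Rightarrow> 'k) \<Rightarrow> ('v \<Rightarrow> 'k) \<Rightarrow> bool"
  where "compatible s \<sigma> f g \<longleftrightarrow>
    Vector_Spaces.linear s (*) f \<and> Vector_Spaces.linear s (*) g \<and>
    (\<forall>t\<in>tensor_power s 2. form_tensor f g (\<sigma> t) = form_tensor g f t) \<and>
    (\<forall>t\<in>tensor_power s 2. form_tensor g f (\<sigma> t) = form_tensor f g t)"

definition braided_character ::
  "('k::field \<Rightarrow> 'v::ab_group_add \<Rightarrow> 'v) \<Rightarrow> (('k, 'v) tensor \<Rightarrow> ('k, 'v) tensor) \<Rightarrow>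
    ('v \<Rightarrow> 'k) \<Rightarrow> bool"
  where "braided_character s \<sigma> \<epsilon> \<longleftrightarrow> Vector_Spaces.linear s (*) \<epsilon> \<and>
    (\<forall>t\<in>tensor_power s 2. form_tensor \<epsilon> \<epsilon> (\<sigma> t) = form_tensor \<epsilon> \<epsilon> t)"

text \<open>A linear form, as a map from the first to the zeroth tensor power.\<close>

definition form_map ::
  "('k::field \<Rightarrow> 'v::ab_group_add \<Rightarrow> 'v) \<Rightarrow> ('v \<Rightarrow> 'k) \<Rightarrow> ('k, 'v) tensor \<Rightarrow> ('k, 'v) tensor"
  where "form_map s f = tensor_lift (\<lambda>vs.
    if length vs = 1 then tensor_scale (f (hd vs)) (tensor_of s []) else 0)"


section \<open>The quantum co-shuffle comultiplication\<close>

definition expresses :: "nat \<Rightarrow> (nat \<Rightarrow> nat) \<Rightarrow> nat list \<Rightarrow> bool"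
  where "expresses n p is \<longleftrightarrow> set is \<subseteq> {1..<n} \<and>
    p = foldr (\<lambda>i q. Transposition.transpose i (Suc i) \<circ> q) is id"

definition reduced_expression :: "nat \<Rightarrow> (nat \<Rightarrow> nat) \<Rightarrow> nat list \<Rightarrow> bool"
  where "reduced_expression n p is \<longleftrightarrow>
    expresses n p is \<and> (\<forall>js. expresses n p js \<longrightarrow> length is \<le> length js)"

definition braid_action ::
  "('k::field \<Rightarrow> 'v::ab_group_add \<Rightarrow> 'v) \<Rightarrow> (('k, 'v) tensor \<Rightarrow> ('k, 'v) tensor) \<Rightarrow> nat \<Rightarrow>
    (nat \<Rightarrow> nat) \<Rightarrow> ('k, 'v) tensor \<Rightarrow> ('k, 'v) tensor"
  where "braid_action s \<beta> n p =
    foldr (\<lambda>i F. apply_at s 2 i \<beta> \<circ> F) (SOME is. reduced_expression n p is) id"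

definition shuffle_perms :: "nat \<Rightarrow> nat \<Rightarrow> (nat \<Rightarrow> nat) set"
  where "shuffle_perms p q = {w. w permutes {1..p + q} \<and>
    strict_mono_on {1..p} w \<and> strict_mono_on {p + 1..p + q} w}"

text \<open>The target \<open>V\<^sup>p \<otimes> V\<^sup>q\<close> (tensor powers) is identified with the tensor power of exponent
  \<open>p + q\<close>.\<close>

definition coshuffle ::
  "('k::field \<Rightarrow> 'v::ab_group_add \<Rightarrow> 'v) \<Rightarrow> (('k, 'v) tensor \<Rightarrow> ('k, 'v) tensor) \<Rightarrow> nat \<Rightarrow> nat \<Rightarrow>
    ('k, 'v) tensor \<Rightarrow> ('k, 'v) tensor"
  where "coshuffle s \<beta> p q t = (\<Sum>w\<in>shuffle_perms p q. braid_action s \<beta> (p + q) (inv w) t)"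


section \<open>The two differentials\<close>

definition left_diff_comp ::
  "('k::field \<Rightarrow> 'v::ab_group_add \<Rightarrow> 'v) \<Rightarrow> (('k, 'v) tensor \<Rightarrow> ('k, 'v) tensor) \<Rightarrow> ('v \<Rightarrow> 'k) \<Rightarrow>
    nat \<Rightarrow> ('k, 'v) tensor \<Rightarrow> ('k, 'v) tensor"
  where "left_diff_comp s \<sigma> \<epsilon> n t =
    apply_at s 1 1 (form_map s \<epsilon>) (coshuffle s (\<lambda>x. - \<sigma> x) 1 (n - 1) t)"

definition right_diff_comp ::
  "('k::field \<Rightarrow> 'v::ab_group_add \<Rightarrow> 'v) \<Rightarrow> (('k, 'v) tensor \<Rightarrow> ('k, 'v) tensor) \<Rightarrow> ('v \<Rightarrow> 'k) \<Rightarrow>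
    nat \<Rightarrow> ('k, 'v) tensor \<Rightarrow> ('k, 'v) tensor"
  where "right_diff_comp s \<sigma> \<epsilon> n t =
    tensor_scale ((- 1) ^ (n - 1))
      (apply_at s 1 n (form_map s \<epsilon>) (coshuffle s (\<lambda>x. - \<sigma> x) (n - 1) 1 t))"

text \<open>The endomorphism of the tensor algebra with the components \<open>D n\<close> for \<open>n \<ge> 1\<close> and \<open>0\<close> in
  degree 0: see lemmas \<open>left_diff_eq\<close> and \<open>right_diff_eq\<close> below.\<close>

definition assemble ::
  "('k::field \<Rightarrow> 'v::ab_group_add \<Rightarrow> 'v) \<Rightarrow> (nat \<Rightarrow> ('k, 'v) tensor \<Rightarrow> ('k, 'v) tensor) \<Rightarrow>
    ('k, 'v) tensor \<Rightarrow> ('k, 'v) tensor"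
  where "assemble s D = tensor_lift (\<lambda>vs. if vs = [] then 0 else D (length vs) (tensor_of s vs))"

definition left_diff ::
  "('k::field \<Rightarrow> 'v::ab_group_add \<Rightarrow> 'v) \<Rightarrow> (('k, 'v) tensor \<Rightarrow> ('k, 'v) tensor) \<Rightarrow> ('v \<Rightarrow> 'k) \<Rightarrow>
    ('k, 'v) tensor \<Rightarrow> ('k, 'v) tensor"
  where "left_diff s \<sigma> \<epsilon> = assemble s (left_diff_comp s \<sigma> \<epsilon>)"

definition right_diff ::
  "('k::field \<Rightarrow> 'v::ab_group_add \<Rightarrow> 'v) \<Rightarrow> (('k, 'v) tensor \<Rightarrow> ('k, 'v) tensor) \<Rightarrow> ('v \<Rightarrow> 'k) \<Rightarrow>
    ('k, 'v) tensor \<Rightarrow> ('k, 'v) tensor"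
  where "right_diff s \<sigma> \<epsilon> = assemble s (right_diff_comp s \<sigma> \<epsilon>)"

lemma linear_tensor_lift: "Vector_Spaces.linear tensor_scale tensor_scale (tensor_lift m)"
  by (simp add: Vector_Spaces.linear_iff tensor.vector_space_axioms tensor_lift_add tensor_lift_scale)

lemma apply_at_add: "apply_at s l i \<phi> (x + y) = apply_at s l i \<phi> x + apply_at s l i \<phi> y"
  unfolding apply_at_def by (rule tensor_lift_add)

lemma apply_at_scale: "apply_at s l i \<phi> (tensor_scale c x) = tensor_scale c (apply_at s l i \<phi> x)"
  unfolding apply_at_def by (rule tensor_lift_scale)

lemma foldr_comp_add:
  fixes x y :: "'a::plus"
  assumes "\<And>i x y. f i (x + y) = f i x + f i y"
  shows "foldr (\<lambda>i F. f i \<circ> F) ks id (x + y) = foldr (\<lambda>i F. f i \<circ> F) ks id x + foldr (\<lambda>i F. f i \<circ> F) ks id y"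
  by (induction ks) (simp_all add: assms)

lemma foldr_comp_commute:
  assumes "\<And>i x. f i (h x) = h (f i x)"
  shows "foldr (\<lambda>i F. f i \<circ> F) ks id (h x) = h (foldr (\<lambda>i F. f i \<circ> F) ks id x)"
  by (induction ks) (simp_all add: assms)

lemma braid_action_add: "braid_action s \<beta> n p (x + y) = braid_action s \<beta> n p x + braid_action s \<beta> n p y"
  unfolding braid_action_def by (rule foldr_comp_add, rule apply_at_add)

lemma braid_action_scale: "braid_action s \<beta> n p (tensor_scale c x) = tensor_scale c (braid_action s \<beta> n p x)"
  unfolding braid_action_def by (rule foldr_comp_commute, rule apply_at_scale)

lemma coshuffle_add: "coshuffle s \<beta> p q (x + y) = coshuffle s \<beta> p q x + coshuffle s \<beta> p q y"
  unfolding coshuffle_def by (simp only: braid_action_add sum.distrib)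

lemma coshuffle_scale: "coshuffle s \<beta> p q (tensor_scale c x) = tensor_scale c (coshuffle s \<beta> p q x)"
  unfolding coshuffle_def by (simp only: braid_action_scale tensor.scale_sum_right)

lemma linear_left_diff_comp: "Vector_Spaces.linear tensor_scale tensor_scale (left_diff_comp s \<sigma> \<epsilon> n)"
  unfolding Vector_Spaces.linear_iff left_diff_comp_def
  by (simp only: tensor.vector_space_axioms coshuffle_add coshuffle_scale apply_at_add apply_at_scale
      simp_thms)

lemma linear_right_diff_comp: "Vector_Spaces.linear tensor_scale tensor_scale (right_diff_comp s \<sigma> \<epsilon> n)"
  unfolding Vector_Spaces.linear_iff right_diff_comp_def
  by (simp only: tensor.vector_space_axioms coshuffle_add coshuffle_scale apply_at_add apply_at_scale
      tensor.scale_right_distrib tensor.scale_left_commute simp_thms)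

lemma assemble_eq:
  assumes s: "vector_space s"
    and D: "\<And>n. Vector_Spaces.linear tensor_scale tensor_scale (D n)"
    and n: "n \<ge> 1" and t: "t \<in> tensor_power s n"
  shows "assemble s D t = D n t"
proof -
  have D1: "D n (x + y) = D n x + D n y" and D2: "D n (tensor_scale c x) = tensor_scale c (D n x)"
    for n x y c
    using D[of n] unfolding Vector_Spaces.linear_iff by blast+
  have T1: "tensor_of s (us @ (v + v') # ws) = tensor_of s (us @ v # ws) + tensor_of s (us @ v' # ws)"
    and T2: "tensor_of s (us @ s c v # ws) = tensor_scale c (tensor_of s (us @ v # ws))" for us ws v v' c
    using multilinear_tensor_of[OF s] unfolding multilinear_def Vector_Spaces.linear_iff by blast+
  have "multilinear s tensor_scale (\<lambda>vs. if vs = [] then 0 else D (length vs) (tensor_of s vs))"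
    using s tensor.vector_space_axioms
    by (simp add: multilinear_def Vector_Spaces.linear_iff T1 T2 D1 D2)
  then have gen: "assemble s D (tensor_of s vs) = D n (tensor_of s vs)" if "length vs = n" for vs
    using n that unfolding assemble_def by (subst tensor_lift_tensor_of) auto
  interpret p: vector_space_pair "tensor_scale :: 'a \<Rightarrow> ('a, 'b) tensor \<Rightarrow> _" "tensor_scale :: 'a \<Rightarrow> ('a, 'b) tensor \<Rightarrow> _"
    by (simp add: vector_space_pair_def tensor.vector_space_axioms)
  show ?thesis
  proof (rule p.linear_eq_on[OF _ D t[unfolded tensor_power_def]])
    show "Vector_Spaces.linear tensor_scale tensor_scale (assemble s D)"
      unfolding assemble_def by (rule linear_tensor_lift)
  qed (use gen in blast)
qed

lemma left_diff_eq:
  "vector_space s \<Longrightarrow> n \<ge> 1 \<Longrightarrow> t \<in> tensor_power s n \<Longrightarrow> left_diff s \<sigma> \<epsilon> t = left_diff_comp s \<sigma> \<epsilon> n t"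
  unfolding left_diff_def by (rule assemble_eq[OF _ linear_left_diff_comp])

lemma right_diff_eq:
  "vector_space s \<Longrightarrow> n \<ge> 1 \<Longrightarrow> t \<in> tensor_power s n \<Longrightarrow> right_diff s \<sigma> \<epsilon> t = right_diff_comp s \<sigma> \<epsilon> n t"
  unfolding right_diff_def by (rule assemble_eq[OF _ linear_right_diff_comp])

end

theory Submission
  imports Defs
begin

text \<open>Write \<open>b\<^sub>i = (-\<sigma>)\<^sub>i\<close>. These operators on \<open>V\<^sup>\<otimes>\<^sup>n\<close> satisfy the braid relations.

  The inverse of a shuffle in \<open>Sh\<^sub>1\<^sub>,\<^sub>n\<^sub>-\<^sub>1\<close> is a cycle that carries some \<open>k\<close> to \<open>1\<close> and has \<open>1, \<dots>, k - 1\<close> as its only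
  reduced word, since a letter moves a point by at most one place (\<open>word_adj_fastest_down\<close>). So the
  co-shuffle is the explicit sum \<open>L\<^sub>n = \<Sum>\<^sub>k b\<^sub>1 \<dots> b\<^sub>k\<^sub>-\<^sub>1\<close>, whichever reduced expression is chosen, and on
  the other side it is \<open>R\<^sub>n = \<Sum>\<^sub>k b\<^sub>n\<^sub>-\<^sub>1 \<dots> b\<^sub>k\<close>.

  Moving \<open>b\<^sub>i\<close> behind the evaluation of a linear form on the first factor turns it into \<open>b\<^sub>i\<^sub>+\<^sub>1\<close>.
  Hence the composite of two left maps is \<open>\<epsilon>\<^sub>1 \<zeta>\<^sub>1\<close> applied to the product of \<open>L\<^sub>n\<close> with a shifted copy of \<open>L\<^sub>n\<^sub>-\<^sub>1\<close>. The braid relations pair off the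
  terms of this product and show that it is \<open>(1 + b\<^sub>1) X\<close> for an explicit \<open>X\<close>
  (\<open>double_shuffle_factor\<close>). Since \<open>b\<^sub>1\<close> carries the sign of \<open>-\<sigma>\<close>, compatibility gives
  \<open>\<epsilon>\<^sub>1 \<zeta>\<^sub>1 (1 + b\<^sub>1) X = \<epsilon>\<^sub>1 \<zeta>\<^sub>1 X - \<zeta>\<^sub>1 \<epsilon>\<^sub>1 X\<close>, which is antisymmetric in the two forms and
  vanishes when they agree. The right maps are treated by the same identity for the mirrored
  operators \<open>b\<^sub>n\<^sub>-\<^sub>i\<close>.

  For a left and a right map, both composites evaluate the two forms on the outermost factors of
  the same tensor: this is coassociativity of the co-shuffle (\<open>coshuffle_coassoc\<close>), again
  a rearrangement by the braid relations. The signs \<open>(-1)\<^sup>n\<^sup>-\<^sup>1\<close> and \<open>(-1)\<^sup>n\<^sup>-\<^sup>2\<close> are opposite, so the two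
  maps anticommute.\<close>

section \<open>Reduced words of one-element shuffles\<close>

definition word :: "(nat \<Rightarrow> 'a \<Rightarrow> 'a) \<Rightarrow> nat list \<Rightarrow> 'a \<Rightarrow> 'a"
  where "word f ks = foldr (\<lambda>i F. f i \<circ> F) ks id"

lemma word_Nil [simp]: "word f [] x = x"
  and word_Cons [simp]: "word f (k # ks) x = f k (word f ks x)"
  by (simp_all add: word_def)

lemma word_append [simp]: "word f (ks @ ls) x = word f ks (word f ls x)"
  by (induction ks) simp_all

lemma word_map: "word f (map h ks) x = word (\<lambda>i. f (h i)) ks x"
  by (induction ks) simp_all

definition adj :: "nat \<Rightarrow> nat \<Rightarrow> nat"
  where "adj i = Transposition.transpose i (Suc i)"

lemma adj_apply: "adj i x = (if x = i then Suc i else if x = Suc i then i else x)"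
  by (simp add: adj_def Transposition.transpose_def)

lemma word_adj_bij: "bij (word adj ks)"
proof (induction ks)
  case Nil
  have "word adj [] = id" by auto
  then show ?case by (simp only: bij_id)
next
  case (Cons k ks)
  have eq: "word adj (k # ks) = adj k \<circ> word adj ks" by auto
  show ?case unfolding eq by (intro bij_comp Cons.IH) (simp add: adj_def)
qed

lemma inv_word_adj: "inv (word adj (rev ks)) = word adj ks"
proof (rule inv_unique_comp)
  show "word adj (rev ks) \<circ> word adj ks = id"
    by (rule ext, induction ks) (simp_all add: adj_def)
  have "word adj ks (word adj (rev ks) x) = x" for x
    by (induction ks arbitrary: x) (simp_all add: adj_def)
  then show "word adj ks \<circ> word adj (rev ks) = id"
    by auto
qed

text \<open>A letter moves a point by at most one place, so a word needs as many letters as the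
  distance that it carries a point; this bounds lengths of expressions from below.\<close>

lemma word_adj_bounds:
  fixes x :: nat
  shows "x \<le> word adj ks x + length ks" "word adj ks x \<le> x + length ks"
proof (induction ks)
  case (Cons k ks)
  { case 1 with Cons show ?case by (auto simp: adj_apply) }
  { case 2 with Cons show ?case by (auto simp: adj_apply) }
qed simp_all

text \<open>In the extremal case every letter must move the point on, which determines the letters one by
  one.\<close>

lemma word_adj_fastest_down:
  "x = word adj ks x + length ks \<Longrightarrow> ks = [word adj ks x..<x]"
proof (induction ks)
  case (Cons k ks)
  have d: "word adj ks x = k + 1" and k: "word adj (k # ks) x = k" and *: "x = word adj ks x + length ks"
    using Cons.prems word_adj_bounds[where x = x and ks = ks] by (auto simp: adj_apply[of k] split: if_splits)
  have "[k..<x] = k # ks"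
    using * d Cons.IH[OF *] by (subst upt_conv_Cons) auto
  then show ?case by (simp only: k)
qed simp

lemma word_adj_fastest_up:
  "word adj ks x = x + length ks \<Longrightarrow> ks = rev [x..<word adj ks x]"
proof (induction ks)
  case (Cons k ks)
  have "word adj ks x = k" and k: "word adj (k # ks) x = Suc k" and *: "word adj ks x = x + length ks"
    using Cons.prems word_adj_bounds[where x = x and ks = ks] by (auto simp: adj_apply[of k] split: if_splits)
  then show ?case using Cons.IH[OF *] by simp
qed simp

lemma expresses_iff: "expresses n p ks \<longleftrightarrow> set ks \<subseteq> {1..<n} \<and> p = word adj ks"
  by (simp add: expresses_def word_def adj_def)

text \<open>The choice made in the definition of the braid action is harmless for a permutation with a
  single reduced word.\<close>

lemma some_reduced_expression:
  assumes ks: "set ks \<subseteq> {1..<n}"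
    and short: "\<And>ls. word adj ls = word adj ks \<Longrightarrow> length ks \<le> length ls \<and> (length ls = length ks \<longrightarrow> ls = ks)"
  shows "(SOME ls. reduced_expression n (word adj ks) ls) = ks"
proof (rule some_equality)
  show red: "reduced_expression n (word adj ks) ks"
    using ks short by (metis expresses_iff reduced_expression_def)
  show "ls = ks" if "reduced_expression n (word adj ks) ls" for ls
    using that red short by (metis expresses_iff reduced_expression_def le_antisym)
qed

lemma word_adj_first: "1 \<le> k \<Longrightarrow> word adj (rev [1..<k]) x = (if x = 1 then k else if 1 < x \<and> x \<le> k then x - 1 else x)"
proof (induction k rule: dec_induct)
  case (step k)
  then show ?case by (auto simp: adj_apply)
qed auto

lemma word_adj_last: "k \<le> n \<Longrightarrow> word adj [k..<n] x = (if x = n then k else if k \<le> x \<and> x < n then x + 1 else x)"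
proof (induction k rule: inc_induct)
  case (step k)
  then show ?case by (auto simp: upt_conv_Cons adj_apply)
qed auto

lemma strict_mono_on_unique:
  fixes f g :: "nat \<Rightarrow> nat"
  assumes "finite A" "strict_mono_on A f" "strict_mono_on A g" "f ` A = g ` A" "x \<in> A"
  shows "f x = g x"
proof -
  let ?l = "sorted_list_of_set A"
  have "sorted_wrt (<) (map h ?l)" if "strict_mono_on A h" for h :: "nat \<Rightarrow> nat"
    unfolding sorted_wrt_map
    by (rule sorted_wrt_mono_rel[OF _ strict_sorted_list_of_set])
      (use that assms(1) in \<open>auto simp: strict_mono_on_def\<close>)
  then have "map f ?l = map g ?l"
    using assms by (intro strict_sorted_equal) auto
  then show ?thesis
    using assms by (simp add: map_eq_conv)
qed

lemma word_adj_permutes: "set ks \<subseteq> {1..<n} \<Longrightarrow> word adj ks permutes {1..n}"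
proof (induction ks)
  case Nil
  have "word adj [] = id" by auto
  then show ?case by (simp only: permutes_id)
next
  case (Cons k ks)
  have eq: "word adj (k # ks) = adj k \<circ> word adj ks" by auto
  have "adj k permutes {1..n}"
    unfolding adj_def using Cons.prems by (intro permutes_swap_id) auto
  with Cons show ?case unfolding eq by (intro permutes_compose) auto
qed

text \<open>A permutation that is increasing off one point is determined by its value there, because
  two increasing functions with the same domain and range agree. So one-element shuffles are
  counted by that value.\<close>

lemma permutes_eq_by_shuffle:
  assumes w: "w permutes {1..n::nat}" and v: "v permutes {1..n}"
    and a: "a \<in> {1..n}" "w a = v a"
    and mono: "strict_mono_on ({1..n} - {a}) w" "strict_mono_on ({1..n} - {a}) v"
  shows "w = v"
proof
  fix x
  have "w ` ({1..n} - {a}) = v ` ({1..n} - {a})"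
    using a permutes_image[OF w] permutes_image[OF v]
    by (simp add: image_set_diff[OF permutes_inj[OF w]] image_set_diff[OF permutes_inj[OF v]])
  from strict_mono_on_unique[OF _ mono this, of x] show "w x = v x"
    using a(2) permutes_not_in[OF w, of x] permutes_not_in[OF v, of x] by (cases "x \<in> {1..n} - {a}") auto
qed

lemma bij_betw_shuffle_perms_left:
  "bij_betw (\<lambda>k. word adj (rev [1..<k])) {1..Suc m} (shuffle_perms 1 m)"
  unfolding bij_betw_def
proof
  show "inj_on (\<lambda>k. word adj (rev [1..<k])) {1..Suc m}"
  proof (rule inj_onI)
    fix k l assume "k \<in> {1..Suc m}" "l \<in> {1..Suc m}" "word adj (rev [1..<k]) = word adj (rev [1..<l])"
    then show "k = l" using word_adj_first[of k 1] word_adj_first[of l 1] by simp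
  qed
  have into: "word adj (rev [1..<k]) \<in> shuffle_perms 1 m" if "k \<in> {1..Suc m}" for k
  proof -
    have "word adj (rev [1..<k]) permutes {1..1 + m}"
      using that by (intro word_adj_permutes) auto
    moreover have "strict_mono_on {1 + 1..1 + m} (word adj (rev [1..<k]))"
      unfolding strict_mono_on_def using that by (auto simp: word_adj_first simp del: One_nat_def)
    ultimately show ?thesis by (simp add: shuffle_perms_def strict_mono_on_def)
  qed
  show "(\<lambda>k. word adj (rev [1..<k])) ` {1..Suc m} = shuffle_perms 1 m"
  proof
    show "(\<lambda>k. word adj (rev [1..<k])) ` {1..Suc m} \<subseteq> shuffle_perms 1 m"
      using into by blast
    show "shuffle_perms 1 m \<subseteq> (\<lambda>k. word adj (rev [1..<k])) ` {1..Suc m}"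
    proof
      fix w assume w: "w \<in> shuffle_perms 1 m"
      then have k: "w 1 \<in> {1..Suc m}"
        using permutes_in_image[of w "{1..Suc m}" 1] by (auto simp: shuffle_perms_def)
      have "{1..Suc m} - {1} = {1 + 1..1 + m}" by auto
      then have mem: "v permutes {1..Suc m} \<and> strict_mono_on ({1..Suc m} - {1}) v" if "v \<in> shuffle_perms 1 m" for v
        using that by (simp add: shuffle_perms_def)
      have "w = word adj (rev [1..<w 1])"
      proof (rule permutes_eq_by_shuffle[where a = 1 and n = "Suc m"])
        show "w 1 = word adj (rev [1..<w 1]) 1"
          using k by (subst word_adj_first) auto
      qed (use k mem[OF w] mem[OF into[OF k]] in auto)
      then show "w \<in> (\<lambda>k. word adj (rev [1..<k])) ` {1..Suc m}" using k by blast
    qed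
  qed
qed

lemma bij_betw_shuffle_perms_right:
  "bij_betw (\<lambda>k. word adj [k..<Suc m]) {1..Suc m} (shuffle_perms m 1)"
  unfolding bij_betw_def
proof
  show "inj_on (\<lambda>k. word adj [k..<Suc m]) {1..Suc m}"
  proof (rule inj_onI)
    fix k l assume "k \<in> {1..Suc m}" "l \<in> {1..Suc m}" "word adj [k..<Suc m] = word adj [l..<Suc m]"
    then show "k = l" using word_adj_last[of k "Suc m" "Suc m"] word_adj_last[of l "Suc m" "Suc m"] by simp
  qed
  have into: "word adj [k..<Suc m] \<in> shuffle_perms m 1" if "k \<in> {1..Suc m}" for k
  proof -
    have "word adj [k..<Suc m] permutes {1..m + 1}"
      using that by (intro word_adj_permutes) auto
    moreover have "strict_mono_on {1..m} (word adj [k..<Suc m])"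
      unfolding strict_mono_on_def using that by (auto simp: word_adj_last simp del: upt_Suc)
    ultimately show ?thesis by (simp add: shuffle_perms_def strict_mono_on_def)
  qed
  show "(\<lambda>k. word adj [k..<Suc m]) ` {1..Suc m} = shuffle_perms m 1"
  proof
    show "(\<lambda>k. word adj [k..<Suc m]) ` {1..Suc m} \<subseteq> shuffle_perms m 1"
      using into by blast
    show "shuffle_perms m 1 \<subseteq> (\<lambda>k. word adj [k..<Suc m]) ` {1..Suc m}"
    proof
      fix w assume w: "w \<in> shuffle_perms m 1"
      then have k: "w (Suc m) \<in> {1..Suc m}"
        using permutes_in_image[of w "{1..Suc m}" "Suc m"] by (auto simp: shuffle_perms_def)
      have "{1..Suc m} - {Suc m} = {1..m}" by auto
      then have mem: "v permutes {1..Suc m} \<and> strict_mono_on ({1..Suc m} - {Suc m}) v" if "v \<in> shuffle_perms m 1" for v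
        using that by (simp add: shuffle_perms_def)
      have "w = word adj [w (Suc m)..<Suc m]"
      proof (rule permutes_eq_by_shuffle[where a = "Suc m" and n = "Suc m"])
        show "w (Suc m) = word adj [w (Suc m)..<Suc m] (Suc m)"
          using k by (subst word_adj_last) auto
      qed (use k mem[OF w] mem[OF into[OF k]] in auto)
      then show "w \<in> (\<lambda>k. word adj [k..<Suc m]) ` {1..Suc m}" using k by blast
    qed
  qed
qed

lemma braid_action_down:
  assumes "1 \<le> k" "k \<le> n"
  shows "braid_action s \<beta> n (word adj [1..<k]) = word (\<lambda>i. apply_at s 2 i \<beta>) [1..<k]"
proof -
  have "word adj (rev [1..<k]) 1 = k"
    using assms by (subst word_adj_first) auto
  then have val: "word adj [1..<k] k = 1"
    by (metis inv_word_adj inv_f_f bij_is_inj word_adj_bij)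
  have "(SOME ls. reduced_expression n (word adj [1..<k]) ls) = [1..<k]"
  proof (rule some_reduced_expression)
    fix ls assume "word adj ls = word adj [1..<k]"
    then have "word adj ls k = 1" using val by simp
    then show "length [1..<k] \<le> length ls \<and> (length ls = length [1..<k] \<longrightarrow> ls = [1..<k])"
      using word_adj_bounds(1)[where x = k and ks = ls] word_adj_fastest_down[where x = k and ks = ls] assms
      by (auto simp del: upt_Suc)
  qed (use assms in auto)
  then show ?thesis by (simp add: braid_action_def word_def)
qed

lemma braid_action_up:
  assumes "1 \<le> k" "k \<le> n"
  shows "braid_action s \<beta> n (word adj (rev [k..<n])) = word (\<lambda>i. apply_at s 2 i \<beta>) (rev [k..<n])"
proof -
  have "word adj [k..<n] n = k"
    using assms by (subst word_adj_last) auto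
  then have val: "word adj (rev [k..<n]) k = n"
    by (metis inv_word_adj rev_rev_ident inv_f_f bij_is_inj word_adj_bij)
  have "(SOME ls. reduced_expression n (word adj (rev [k..<n])) ls) = rev [k..<n]"
  proof (rule some_reduced_expression)
    fix ls assume "word adj ls = word adj (rev [k..<n])"
    then have "word adj ls k = n" using val by simp
    then show "length (rev [k..<n]) \<le> length ls \<and> (length ls = length (rev [k..<n]) \<longrightarrow> ls = rev [k..<n])"
      using word_adj_bounds(2)[where x = k and ks = ls] word_adj_fastest_up[where x = k and ks = ls] assms
      by auto
  qed (use assms in auto)
  then show ?thesis by (simp add: braid_action_def word_def)
qed

lemma coshuffle_left:
  "coshuffle s \<beta> 1 m t = (\<Sum>k = 1..Suc m. word (\<lambda>i. apply_at s 2 i \<beta>) [1..<k] t)"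
proof -
  have "coshuffle s \<beta> 1 m t =
      (\<Sum>k = 1..Suc m. braid_action s \<beta> (1 + m) (inv (word adj (rev [1..<k]))) t)"
    unfolding coshuffle_def by (rule sum.reindex_bij_betw[OF bij_betw_shuffle_perms_left, symmetric])
  also have "\<dots> = (\<Sum>k = 1..Suc m. word (\<lambda>i. apply_at s 2 i \<beta>) [1..<k] t)"
    by (rule sum.cong) (simp_all only: inv_word_adj braid_action_down atLeastAtMost_iff plus_1_eq_Suc)
  finally show ?thesis .
qed

lemma coshuffle_right:
  "coshuffle s \<beta> m 1 t = (\<Sum>k = 1..Suc m. word (\<lambda>i. apply_at s 2 i \<beta>) (rev [k..<Suc m]) t)"
proof -
  have "coshuffle s \<beta> m 1 t =
      (\<Sum>k = 1..Suc m. braid_action s \<beta> (m + 1) (inv (word adj [k..<Suc m])) t)"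
    unfolding coshuffle_def by (rule sum.reindex_bij_betw[OF bij_betw_shuffle_perms_right, symmetric])
  also have "\<dots> = (\<Sum>k = 1..Suc m. word (\<lambda>i. apply_at s 2 i \<beta>) (rev [k..<Suc m]) t)"
    by (rule sum.cong)
      (simp_all only: inv_word_adj[of "rev _", unfolded rev_rev_ident] braid_action_up
        atLeastAtMost_iff Suc_eq_plus1)
  finally show ?thesis .
qed

section \<open>Operators satisfying the braid relations\<close>

text \<open>The relations are required on \<open>W\<close> only, because the maps \<open>\<phi>\<^sub>i\<close> are functions on a type that is
  larger than the tensor power on which they are meaningful.\<close>

locale braid_relations =
  fixes W :: "'a::ab_group_add set" and n :: nat and b :: "nat \<Rightarrow> 'a \<Rightarrow> 'a"
  assumes add: "b i (x + y) = b i x + b i y"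
    and closed: "x \<in> W \<Longrightarrow> 1 \<le> i \<Longrightarrow> i < n \<Longrightarrow> b i x \<in> W"
    and far: "x \<in> W \<Longrightarrow> 1 \<le> i \<Longrightarrow> i + 1 < j \<Longrightarrow> j < n \<Longrightarrow> b i (b j x) = b j (b i x)"
    and braid: "x \<in> W \<Longrightarrow> 1 \<le> i \<Longrightarrow> i + 1 < n \<Longrightarrow>
      b i (b (i + 1) (b i x)) = b (i + 1) (b i (b (i + 1) x))"
begin

lemma word_closed: "set ks \<subseteq> {1..<n} \<Longrightarrow> x \<in> W \<Longrightarrow> word b ks x \<in> W"
  by (induction ks) (auto simp: closed)

lemma letter_far:
  assumes "x \<in> W" "1 \<le> i" "i < n" "set ks \<subseteq> {1..<n}" "\<forall>j\<in>set ks. i + 1 < j \<or> j + 1 < i"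
  shows "b i (word b ks x) = word b ks (b i x)"
  using assms(4,5)
proof (induction ks)
  case (Cons j ks)
  have "b i (b j y) = b j (b i y)" if "y \<in> W" for y
    using Cons.prems that assms far[of y i j] far[of y j i] by auto
  then show ?case using Cons assms word_closed[of ks x] by simp
qed simp

lemma words_far:
  assumes "x \<in> W" "set js \<subseteq> {1..<n}" "set ks \<subseteq> {1..<n}"
    "\<forall>i\<in>set js. \<forall>j\<in>set ks. i + 1 < j \<or> j + 1 < i"
  shows "word b js (word b ks x) = word b ks (word b js x)"
  using assms(2,4)
proof (induction js)
  case (Cons i js)
  then show ?case
    using assms letter_far[of "word b js x" i ks] word_closed[of js x] by simp
qed simp

text \<open>The braid relation is applied once, where the word contains \<open>i, i + 1\<close>; the other letters
  commute with what passes them.\<close>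

lemma letter_slide:
  assumes x: "x \<in> W" and i: "1 \<le> i" "i + 1 < k" "k \<le> n"
  shows "word b [1..<k] (b i x) = b (i + 1) (word b [1..<k] x)"
proof -
  have "[1..<k] = [1..<i] @ [i..<k]"
    using i upt_add_eq_append[of 1 i "k - i"] by simp
  also have "[i..<k] = [i, i + 1] @ [i + 2..<k]"
    using i by (simp add: upt_conv_Cons)
  finally have split: "word b [1..<k] y = word b [1..<i] (b i (b (i + 1) (word b [i + 2..<k] y)))" for y
    by simp
  define y where "y = word b [i + 2..<k] x"
  have y: "y \<in> W" unfolding y_def using i x by (intro word_closed) auto
  have "b i x \<in> W" using i x by (intro closed) auto
  have "word b [i + 2..<k] (b i x) = b i y"
    unfolding y_def using i x by (intro letter_far[symmetric]) auto
  then have "word b [1..<k] (b i x) = word b [1..<i] (b i (b (i + 1) (b i y)))"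
    by (simp only: split)
  also have "\<dots> = word b [1..<i] (b (i + 1) (b i (b (i + 1) y)))"
    using i y by (subst braid) auto
  also have "\<dots> = b (i + 1) (word b [1..<i] (b i (b (i + 1) y)))"
    using i y by (intro letter_far[symmetric] closed) auto
  also have "\<dots> = b (i + 1) (word b [1..<k] x)"
    by (simp only: split y_def)
  finally show ?thesis .
qed

lemma word_slide:
  assumes "x \<in> W" "set js \<subseteq> {1..<k - 1}" "k \<le> n"
  shows "word b (map Suc js) (word b [1..<k] x) = word b [1..<k] (word b js x)"
  using assms(2)
proof (induction js)
  case (Cons i js)
  have "set js \<subseteq> {1..<n}" using Cons.prems assms(3) by (auto simp: subset_eq)
  then have "word b js x \<in> W" using assms(1) by (rule word_closed)
  then show ?case using Cons assms letter_slide[of "word b js x" i k] by auto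
qed simp

text \<open>The terms \<open>(b\<^sub>2 \<dots> b\<^sub>j) (b\<^sub>1 \<dots> b\<^sub>k\<^sub>-\<^sub>1)\<close> with \<open>k \<le> j\<close>: half of the terms of the product of the shifted
  sum with the sum itself, and in effect a co-shuffle that splits off two factors at once.\<close>

definition half_sum :: "'a \<Rightarrow> 'a"
  where "half_sum x = (\<Sum>(j, k) \<in> {(j, k). 1 \<le> k \<and> k \<le> j \<and> j < n}.
    word b [2..<Suc j] (word b [1..<k] x))"

lemma additive_b: "additive (b i)"
  by (simp add: additive_def add)

lemma half_sum_closed:
  assumes "0 \<in> W" "\<And>x y. x \<in> W \<Longrightarrow> y \<in> W \<Longrightarrow> x + y \<in> W" "x \<in> W"
  shows "half_sum x \<in> W"
proof -
  have sum: "sum f A \<in> W" if "\<And>a. a \<in> A \<Longrightarrow> f a \<in> W" for f and A :: "(nat \<times> nat) set"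
    using that by (induction A rule: infinite_finite_induct) (auto simp: assms)
  show ?thesis unfolding half_sum_def
    by (rule sum) (auto intro!: word_closed assms(3))
qed

text \<open>For \<open>k \<le> j\<close>, multiplying the term at \<open>(j, k)\<close> by \<open>b\<^sub>1\<close> completes its first word to
  \<open>b\<^sub>1 \<dots> b\<^sub>j\<close>; sliding the second word through gives the term at \<open>(k, j + 1)\<close>. This is a bijection
  from the terms with \<open>k \<le> j\<close> to those with \<open>j < k\<close>.\<close>

lemma double_shuffle_factor:
  assumes x: "x \<in> W"
  shows "(\<Sum>j = 1..n - 1. \<Sum>k = 1..n. word b [2..<Suc j] (word b [1..<k] x)) =
    half_sum x + b 1 (half_sum x)"
proof -
  define f where "f = (\<lambda>(j, k). word b [2..<Suc j] (word b [1..<k] x))"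
  define A where "A = {(j, k). 1 \<le> k \<and> k \<le> j \<and> j < n}"
  define C where "C = {(j, k). 1 \<le> j \<and> j < k \<and> k \<le> n}"
  have un: "{1..n - 1} \<times> {1..n} = A \<union> C" and disj: "A \<inter> C = {}"
    by (auto simp: A_def C_def)
  have "finite (A \<union> C)" unfolding un[symmetric] by simp
  then have fin: "finite A" "finite C" by simp_all
  have swap: "b 1 (f (j, k)) = f (k, Suc j)" if "1 \<le> k" "k \<le> j" "j < n" for j k
  proof -
    have "b 1 (f (j, k)) = word b [1..<Suc j] (word b [1..<k] x)"
      using that by (subst upt_conv_Cons[of 1]) (auto simp: f_def numeral_2_eq_2 simp del: upt_Suc)
    also have "\<dots> = word b (map Suc [1..<k]) (word b [1..<Suc j] x)"
      using that x by (subst word_slide) auto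
    finally show ?thesis by (simp add: f_def map_Suc_upt numeral_2_eq_2 del: upt_Suc)
  qed
  have swap': "b 1 (f (k - 1, j)) = f (j, k)" if "1 \<le> j" "j < k" "k \<le> n" for j k
    using swap[of j "k - 1"] that by simp
  have "(\<Sum>j = 1..n - 1. \<Sum>k = 1..n. word b [2..<Suc j] (word b [1..<k] x)) = sum f (A \<union> C)"
    by (simp only: f_def sum.cartesian_product un)
  also have "\<dots> = sum f A + sum f C"
    using fin disj by (rule sum.union_disjoint)
  also have "sum f C = (\<Sum>p\<in>A. b 1 (f p))"
    by (rule sum.reindex_bij_witness[where i = "\<lambda>(j, k). (k, Suc j)" and j = "\<lambda>(k, j). (j - 1, k)"])
      (auto simp: A_def C_def swap'[simplified])
  also have "\<dots> = b 1 (sum f A)"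
    by (rule additive.sum[OF additive_b, symmetric])
  finally show ?thesis by (simp add: half_sum_def f_def A_def)
qed

text \<open>Both sides are \<open>b\<^sub>1 \<dots> b\<^sub>j\<^sub>-\<^sub>1 b\<^sub>n\<^sub>-\<^sub>1 \<dots> b\<^sub>k\<close>: the letters \<open>j, \<dots>, k + 1\<close> drop to \<open>j - 1, \<dots>, k\<close> when they slide through
  \<open>b\<^sub>1 \<dots> b\<^sub>j\<close>, and the letters above \<open>j\<close> commute with \<open>b\<^sub>1 \<dots> b\<^sub>j\<^sub>-\<^sub>1\<close>.\<close>

lemma opposite_words_exchange:
  assumes x: "x \<in> W" and jk: "1 \<le> k" "k \<le> j" "j < n"
  shows "word b (rev [Suc k..<n]) (word b [1..<Suc j] x) = word b [1..<j] (word b (rev [k..<n]) x)"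
proof -
  have split: "[Suc k..<n] = [Suc k..<Suc j] @ [Suc j..<n]" "[k..<n] = [k..<Suc j] @ [Suc j..<n]"
    using jk upt_add_eq_append[of "Suc k" "Suc j" "n - Suc j"] upt_add_eq_append[of k "Suc j" "n - Suc j"]
    by (simp_all del: upt_Suc)
  have "word b (rev [Suc k..<Suc j]) (word b [1..<Suc j] x) =
      word b (map Suc (rev [k..<j])) (word b [1..<Suc j] x)"
    by (simp only: rev_map[symmetric] map_Suc_upt)
  also have "\<dots> = word b [1..<Suc j] (word b (rev [k..<j]) x)"
    using jk x by (intro word_slide) auto
  also have "\<dots> = word b [1..<j] (word b (rev [k..<Suc j]) x)"
    using jk by simp
  finally have "word b (rev [Suc k..<n]) (word b [1..<Suc j] x) =
      word b (rev [Suc j..<n]) (word b [1..<j] (word b (rev [k..<Suc j]) x))"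
    by (simp only: split rev_append word_append)
  also have "\<dots> = word b [1..<j] (word b (rev [Suc j..<n]) (word b (rev [k..<Suc j]) x))"
    using jk x by (intro words_far word_closed) auto
  also have "\<dots> = word b [1..<j] (word b (rev [k..<n]) x)"
    by (simp only: split rev_append word_append)
  finally show ?thesis .
qed

text \<open>The two sums split off a first and a last factor in either order. Their terms match in pairs:
  when \<open>j < k\<close> the two words have distant letters and commute, otherwise they are exchanged by
  the preceding lemma.\<close>

lemma coshuffle_coassoc:
  assumes x: "x \<in> W"
  shows "(\<Sum>j = 1..n - 1. \<Sum>k = 1..n. word b [1..<j] (word b (rev [k..<n]) x)) =
    (\<Sum>k = 1..n - 1. \<Sum>j = 1..n. word b (rev [Suc k..<n]) (word b [1..<j] x))"
  unfolding sum.cartesian_product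
proof (rule sum.reindex_bij_witness[
      where i = "\<lambda>(k, j). if j \<le> k then (j, Suc k) else (j - 1, k)"
        and j = "\<lambda>(j, k). if j < k then (k - 1, j) else (k, Suc j)"])
  fix p assume p: "p \<in> {1..n - 1} \<times> {1..n}"
  obtain j k where jk: "p = (j, k)" "1 \<le> j" "j < n" "1 \<le> k" "k \<le> n"
    using p by (cases p) auto
  show "(case case p of (j, k) \<Rightarrow> if j < k then (k - 1, j) else (k, Suc j) of
      (k, j) \<Rightarrow> word b (rev [Suc k..<n]) (word b [1..<j] x)) =
    (case p of (j, k) \<Rightarrow> word b [1..<j] (word b (rev [k..<n]) x))"
  proof (cases "j < k")
    case True
    have "word b (rev [k..<n]) (word b [1..<j] x) = word b [1..<j] (word b (rev [k..<n]) x)"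
      using jk True x by (intro words_far) auto
    then show ?thesis using jk True by simp
  next
    case False
    then show ?thesis using jk opposite_words_exchange[OF x, of k j] by (simp del: upt_Suc)
  qed
qed (auto split: if_splits)

end

text \<open>Reversing the order of the tensor factors preserves the relations, so facts about the left end
  yield facts about the right end.\<close>

lemma (in braid_relations) mirror: "braid_relations W n (\<lambda>i. b (n - i))"
proof
  fix x and i j :: nat
  assume x: "x \<in> W" and i: "1 \<le> i"
  show "i < n \<Longrightarrow> b (n - i) x \<in> W"
    using x i by (simp add: closed)
  show "i + 1 < j \<Longrightarrow> j < n \<Longrightarrow> b (n - i) (b (n - j) x) = b (n - j) (b (n - i) x)"
    using x i by (simp add: far)
  show "i + 1 < n \<Longrightarrow> b (n - i) (b (n - (i + 1)) (b (n - i) x)) =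
    b (n - (i + 1)) (b (n - i) (b (n - (i + 1)) x))"
    using x i braid[of x "n - (i + 1)"] by (simp add: Suc_diff_Suc)
qed (rule add)

section \<open>Tensor powers and the maps acting on consecutive factors\<close>

locale tensor_setting =
  fixes s :: "'k::field \<Rightarrow> 'v::ab_group_add \<Rightarrow> 'v"
  assumes vs: "vector_space s"
begin

abbreviation T :: "nat \<Rightarrow> ('k, 'v) tensor set"
  where "T n \<equiv> tensor_power s n"

abbreviation prod_T :: "('k, 'v) tensor \<Rightarrow> ('k, 'v) tensor \<Rightarrow> ('k, 'v) tensor"  (infixr "\<odot>" 70)
  where "x \<odot> y \<equiv> tensor_prod s x y"

abbreviation lin :: "('k, 'v) tensor set \<Rightarrow> (('k, 'v) tensor \<Rightarrow> ('k, 'v) tensor) \<Rightarrow> bool"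
  where "lin W F \<equiv> linear_on tensor_scale tensor_scale W F"

lemma tensor_of_power [simp]: "length xs = n \<Longrightarrow> tensor_of s xs \<in> T n"
  by (auto simp: tensor_power_def intro: tensor.span_base)

lemma power_zero: "0 \<in> T n"
  and power_add: "x \<in> T n \<Longrightarrow> y \<in> T n \<Longrightarrow> x + y \<in> T n"
  and power_scale: "x \<in> T n \<Longrightarrow> tensor_scale c x \<in> T n"
  unfolding tensor_power_def by (rule tensor.span_zero tensor.span_add tensor.span_scale; assumption)+

lemma power_sum: "(\<And>a. a \<in> A \<Longrightarrow> f a \<in> T n) \<Longrightarrow> sum f A \<in> T n"
  unfolding tensor_power_def by (rule tensor.span_sum)

lemma power_algebra: "x \<in> T n \<Longrightarrow> x \<in> tensor_algebra s"
  unfolding tensor_power_def tensor_algebra_def using tensor.span_mono[of _ "range (tensor_of s)"] by blast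

lemma power_induct [consumes 1, case_names zero step]:
  assumes "t \<in> T n" "P 0"
    and "\<And>c xs t. length xs = n \<Longrightarrow> t \<in> T n \<Longrightarrow> P t \<Longrightarrow> P (tensor_scale c (tensor_of s xs) + t)"
  shows "P t"
proof -
  have "t \<in> T n \<and> P t"
  proof (rule tensor.span_induct_alt[OF assms(1)[unfolded tensor_power_def]])
    show "0 \<in> T n \<and> P 0"
      using assms(2) power_zero by blast
    show "tensor_scale c x + y \<in> T n \<and> P (tensor_scale c x + y)"
      if "x \<in> tensor_of s ` {xs. length xs = n}" "y \<in> T n \<and> P y" for c x y
      using that assms(3) by (auto intro!: power_add power_scale)
  qed
  then show ?thesis ..
qed

lemma lin_zero: "lin W F \<Longrightarrow> 0 \<in> W \<Longrightarrow> F 0 = 0"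
  unfolding linear_on_def by (metis tensor.scale_zero_left)

lemma lin_step:
  assumes "lin (T n) F" "length xs = n" "t \<in> T n"
  shows "F (tensor_scale c (tensor_of s xs) + t) = tensor_scale c (F (tensor_of s xs)) + F t"
  using assms by (simp add: linear_on_def power_scale)

lemma lin_eq_on_power:
  assumes "t \<in> T n" "lin (T n) F" "lin (T n) G"
    and "\<And>xs. length xs = n \<Longrightarrow> F (tensor_of s xs) = G (tensor_of s xs)"
  shows "F t = G t"
  using assms(1)
proof (induction rule: power_induct)
  case zero
  show ?case using assms(2,3) by (simp only: lin_zero power_zero)
next
  case (step c xs t)
  then show ?case using assms by (simp only: lin_step)
qed

lemma lin_into_power:
  assumes "t \<in> T n" "lin (T n) F" and "\<And>xs. length xs = n \<Longrightarrow> F (tensor_of s xs) \<in> T m"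
  shows "F t \<in> T m"
  using assms(1)
proof (induction rule: power_induct)
  case zero
  show ?case using assms(2) by (simp only: lin_zero power_zero)
next
  case (step c xs t)
  then show ?case using assms by (simp only: lin_step power_add power_scale)
qed

lemma lin_subset: "lin W F \<Longrightarrow> V \<subseteq> W \<Longrightarrow> lin V F"
  unfolding linear_on_def by blast

lemma lin_prod_left: "lin W F \<Longrightarrow> lin W (\<lambda>x. F x \<odot> y)"
  using tensor_prod_left_linear[of s y] by (simp add: linear_on_def Vector_Spaces.linear_iff)

lemma lin_prod_right:
  "x \<in> tensor_algebra s \<Longrightarrow> lin W F \<Longrightarrow> (\<And>y. y \<in> W \<Longrightarrow> F y \<in> tensor_algebra s) \<Longrightarrow> lin W (\<lambda>y. x \<odot> F y)"
  using tensor_prod_right_linear[OF vs, of x] by (simp add: linear_on_def)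

lemma lin_id: "lin W (\<lambda>x. x)"
  by (simp add: linear_on_def)

lemma lin_apply_at: "lin W F \<Longrightarrow> lin W (\<lambda>x. apply_at s l i \<phi> (F x))"
  by (simp add: linear_on_def apply_at_add apply_at_scale)

lemmas prod_tensor_of = tensor_prod_tensor_of[OF vs]

lemma prod_power:
  assumes x: "x \<in> T a" and y: "y \<in> T c"
  shows "x \<odot> y \<in> T (a + c)"
  using x
proof (rule lin_into_power)
  show "lin (T a) (\<lambda>x. x \<odot> y)" by (intro lin_prod_left lin_id)
  fix us :: "'v list" assume us: "length us = a"
  show "tensor_of s us \<odot> y \<in> T (a + c)"
    using y
  proof (rule lin_into_power)
    show "lin (T c) (\<lambda>y. tensor_of s us \<odot> y)"
      by (intro lin_prod_right lin_id tensor_of_in_algebra power_algebra)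
  qed (simp add: us prod_tensor_of)
qed

lemma prod_assoc:
  assumes x: "x \<in> T a" and y: "y \<in> T c" and z: "z \<in> T d"
  shows "(x \<odot> y) \<odot> z = x \<odot> y \<odot> z"
  using x
proof (rule lin_eq_on_power)
  show "lin (T a) (\<lambda>x. (x \<odot> y) \<odot> z)" "lin (T a) (\<lambda>x. x \<odot> y \<odot> z)"
    by (intro lin_prod_left lin_id)+
  fix us :: "'v list" assume us: "length us = a"
  show "(tensor_of s us \<odot> y) \<odot> z = tensor_of s us \<odot> y \<odot> z"
    using y
  proof (rule lin_eq_on_power)
    show "lin (T c) (\<lambda>y. (tensor_of s us \<odot> y) \<odot> z)" "lin (T c) (\<lambda>y. tensor_of s us \<odot> y \<odot> z)"
      using z by (auto intro!: lin_prod_left lin_prod_right lin_id tensor_prod_in_algebra vs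
          intro: power_algebra)
    fix ws :: "'v list" assume ws: "length ws = c"
    show "(tensor_of s us \<odot> tensor_of s ws) \<odot> z = tensor_of s us \<odot> tensor_of s ws \<odot> z"
      using z
    proof (rule lin_eq_on_power)
      show "lin (T d) (\<lambda>z. (tensor_of s us \<odot> tensor_of s ws) \<odot> z)"
        "lin (T d) (\<lambda>z. tensor_of s us \<odot> tensor_of s ws \<odot> z)"
        by (auto intro!: lin_prod_right lin_id tensor_prod_in_algebra vs intro: power_algebra)
    qed (simp add: prod_tensor_of)
  qed
qed

lemma unit_prod: "x \<in> T a \<Longrightarrow> tensor_of s [] \<odot> x = x"
  by (rule lin_eq_on_power[where F = "\<lambda>x. tensor_of s [] \<odot> x" and G = "\<lambda>x. x"])
    (auto intro!: lin_prod_right lin_id simp: prod_tensor_of intro: power_algebra)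

lemma prod_unit: "x \<in> T a \<Longrightarrow> x \<odot> tensor_of s [] = x"
  by (rule lin_eq_on_power[where F = "\<lambda>x. x \<odot> tensor_of s []" and G = "\<lambda>x. x"])
    (auto intro!: lin_prod_left lin_id simp: prod_tensor_of)

text \<open>Identities between maps that act on several blocks of factors are checked on products of
  blocks rather than on decomposable tensors, since the image of a decomposable tensor is in
  general not decomposable.\<close>

lemma lin_eq_on_prods:
  assumes t: "t \<in> T (a + c)" and F: "lin UNIV F" and G: "lin UNIV G"
    and eq: "\<And>x y. x \<in> T a \<Longrightarrow> y \<in> T c \<Longrightarrow> F (x \<odot> y) = G (x \<odot> y)"
  shows "F t = G t"
  using t
proof (rule lin_eq_on_power)
  fix xs :: "'v list" assume "length xs = a + c"
  then show "F (tensor_of s xs) = G (tensor_of s xs)"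
    using eq[of "tensor_of s (take a xs)" "tensor_of s (drop a xs)"] by (simp add: prod_tensor_of)
qed (use F G in \<open>auto intro: lin_subset\<close>)

end

lemma split_three:
  assumes "length xs = a + l + c"
  obtains us ys ws where "xs = us @ ys @ ws" "length us = a" "length ys = l" "length ws = c"
proof
  show "xs = take a xs @ take l (drop a xs) @ drop l (drop a xs)"
    by (simp only: append_take_drop_id)
qed (use assms in simp_all)

locale tensor_map = tensor_setting s
  for s :: "'k::field \<Rightarrow> 'v::ab_group_add \<Rightarrow> 'v" +
  fixes \<phi> :: "('k, 'v) tensor \<Rightarrow> ('k, 'v) tensor" and l r :: nat
  assumes lin_\<phi>: "lin (T l) \<phi>" and \<phi>_power: "t \<in> T l \<Longrightarrow> \<phi> t \<in> T r"
begin

lemma apply_at_decomposed: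
  assumes "length us = i - 1" "length xs = l"
  shows "apply_at s l i \<phi> (tensor_of s (us @ xs @ ws)) =
    tensor_of s us \<odot> \<phi> (tensor_of s xs) \<odot> tensor_of s ws"
  using assms by (intro apply_at_tensor_of vs lin_\<phi>) (auto intro: power_algebra \<phi>_power)

lemma apply_at_power:
  assumes t: "t \<in> T m" and m: "m = i - 1 + l + c"
  shows "apply_at s l i \<phi> t \<in> T (i - 1 + r + c)"
  using t
proof (rule lin_into_power)
  show "lin (T m) (apply_at s l i \<phi>)" by (rule lin_apply_at[OF lin_id])
  fix xs :: "'v list" assume len: "length xs = m"
  then obtain us ys ws where "xs = us @ ys @ ws" "length us = i - 1" "length ys = l" "length ws = c"
    using split_three[of xs "i - 1" l c] m by metis
  then show "apply_at s l i \<phi> (tensor_of s xs) \<in> T (i - 1 + r + c)"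
    using prod_power[of _ "i - 1" _ "r + c"]
    by (simp add: apply_at_decomposed add.assoc prod_power \<phi>_power)
qed

text \<open>Together with the next lemma this lets one compute \<open>\<phi>\<^sub>i\<close> on a product of arbitrary, not
  necessarily decomposable, blocks, which is all that the commutation and braid relations need.\<close>

lemma apply_at_shift:
  assumes x: "x \<in> T a" and y: "y \<in> T m" and i: "1 \<le> i" "i - 1 + l \<le> m"
  shows "apply_at s l (a + i) \<phi> (x \<odot> y) = x \<odot> apply_at s l i \<phi> y"
proof -
  obtain c where m: "m = i - 1 + l + c" using i le_Suc_ex by blast
  have alg: "apply_at s l i \<phi> y \<in> tensor_algebra s" if "y \<in> T m" for y
    using apply_at_power[OF that m] by (rule power_algebra)
  show ?thesis
    using x
  proof (rule lin_eq_on_power)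
    show "lin (T a) (\<lambda>x. apply_at s l (a + i) \<phi> (x \<odot> y))" "lin (T a) (\<lambda>x. x \<odot> apply_at s l i \<phi> y)"
      by (intro lin_apply_at lin_prod_left lin_id)+
    fix zs :: "'v list" assume zs: "length zs = a"
    show "apply_at s l (a + i) \<phi> (tensor_of s zs \<odot> y) = tensor_of s zs \<odot> apply_at s l i \<phi> y"
      using y
    proof (rule lin_eq_on_power)
      show "lin (T m) (\<lambda>y. apply_at s l (a + i) \<phi> (tensor_of s zs \<odot> y))"
        "lin (T m) (\<lambda>y. tensor_of s zs \<odot> apply_at s l i \<phi> y)"
        by (auto intro!: lin_apply_at lin_prod_right lin_id alg intro: power_algebra)
      fix xs :: "'v list" assume len: "length xs = m"
      then obtain us ys ws where xs: "xs = us @ ys @ ws"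
        and len: "length us = i - 1" "length ys = l" "length ws = c"
        using split_three[of xs "i - 1" l c] m by metis
      have "\<phi> (tensor_of s ys) \<odot> tensor_of s ws \<in> T (r + c)"
        using len by (simp add: prod_power \<phi>_power)
      then have "tensor_of s (zs @ us) \<odot> \<phi> (tensor_of s ys) \<odot> tensor_of s ws =
          tensor_of s zs \<odot> tensor_of s us \<odot> \<phi> (tensor_of s ys) \<odot> tensor_of s ws"
        using prod_assoc[of "tensor_of s zs" a "tensor_of s us" "i - 1" _ "r + c"] zs len
        by (simp add: prod_tensor_of)
      then show "apply_at s l (a + i) \<phi> (tensor_of s zs \<odot> tensor_of s xs) =
          tensor_of s zs \<odot> apply_at s l i \<phi> (tensor_of s xs)"
        using zs len i apply_at_decomposed[of "zs @ us" "a + i" ys ws] apply_at_decomposed[of us i ys ws]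
        by (simp add: xs prod_tensor_of)
    qed
  qed
qed

lemma apply_at_right:
  assumes y: "y \<in> T m" and z: "z \<in> T d" and i: "i - 1 + l \<le> m"
  shows "apply_at s l i \<phi> (y \<odot> z) = apply_at s l i \<phi> y \<odot> z"
proof -
  obtain c where m: "m = i - 1 + l + c" using i le_Suc_ex by blast
  show ?thesis
    using y
  proof (rule lin_eq_on_power)
    show "lin (T m) (\<lambda>y. apply_at s l i \<phi> (y \<odot> z))" "lin (T m) (\<lambda>y. apply_at s l i \<phi> y \<odot> z)"
      by (intro lin_apply_at lin_prod_left lin_id)+
    fix xs :: "'v list" assume lxs: "length xs = m"
    show "apply_at s l i \<phi> (tensor_of s xs \<odot> z) = apply_at s l i \<phi> (tensor_of s xs) \<odot> z"
      using z
    proof (rule lin_eq_on_power)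
      show "lin (T d) (\<lambda>z. apply_at s l i \<phi> (tensor_of s xs \<odot> z))"
        by (auto intro!: lin_apply_at lin_prod_right lin_id intro: power_algebra)
      show "lin (T d) (\<lambda>z. apply_at s l i \<phi> (tensor_of s xs) \<odot> z)"
        using apply_at_power[of "tensor_of s xs" m i c] lxs m
        by (auto intro!: lin_prod_right lin_id intro: power_algebra)
      fix zs :: "'v list" assume zs: "length zs = d"
      obtain us ys ws where xs: "xs = us @ ys @ ws"
        and len: "length us = i - 1" "length ys = l" "length ws = c"
        using split_three[of xs "i - 1" l c] lxs m by metis
      have mem: "tensor_of s us \<in> T (i - 1)" "\<phi> (tensor_of s ys) \<in> T r" "tensor_of s ws \<in> T c"
        "tensor_of s zs \<in> T d" "\<phi> (tensor_of s ys) \<odot> tensor_of s ws \<in> T (r + c)"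
        using len zs by (simp_all add: prod_power \<phi>_power)
      have "tensor_of s us \<odot> \<phi> (tensor_of s ys) \<odot> tensor_of s (ws @ zs) =
          (tensor_of s us \<odot> \<phi> (tensor_of s ys) \<odot> tensor_of s ws) \<odot> tensor_of s zs"
        using prod_assoc[OF mem(1,5,4)] prod_assoc[OF mem(2,3,4)] by (simp add: prod_tensor_of)
      then show "apply_at s l i \<phi> (tensor_of s xs \<odot> tensor_of s zs) =
          apply_at s l i \<phi> (tensor_of s xs) \<odot> tensor_of s zs"
        using len apply_at_decomposed[of us i ys ws] apply_at_decomposed[of us i ys "ws @ zs"]
        by (simp add: xs prod_tensor_of)
    qed
  qed
qed

lemma apply_at_self:
  assumes "t \<in> T l"
  shows "apply_at s l 1 \<phi> t = \<phi> t"
  using assms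
proof (rule lin_eq_on_power)
  show "lin (T l) (apply_at s l 1 \<phi>)" by (rule lin_apply_at[OF lin_id])
  show "lin (T l) \<phi>" by (rule lin_\<phi>)
  show "apply_at s l 1 \<phi> (tensor_of s xs) = \<phi> (tensor_of s xs)" if "length xs = l" for xs
    using that apply_at_decomposed[of "[]" 1 xs "[]"] \<phi>_power[of "tensor_of s xs"]
    by (simp add: unit_prod prod_unit)
qed

end

text \<open>Maps acting on disjoint blocks of factors commute, up to the shift of position that the
  left one causes. This one identity covers distant braid operators (shift zero), a form on the
  first factor against a braid operator (shift by one), a braid operator against a form on the
  last factor, and two forms.\<close>

lemma apply_at_commute:
  assumes "tensor_map s \<phi> l r" and "tensor_map s \<psi> l' r'"
    and t: "t \<in> tensor_power s n" and i: "1 \<le> i" "i + l \<le> j" "j - 1 + l' \<le> n"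
  shows "apply_at s l i \<phi> (apply_at s l' j \<psi> t) =
    apply_at s l' (j - l + r) \<psi> (apply_at s l i \<phi> t)"
proof -
  interpret \<phi>: tensor_map s \<phi> l r by fact
  interpret \<psi>: tensor_map s \<psi> l' r' by fact
  define a c where "a = i - 1 + l" and "c = n - a"
  define k where "k = j - a"
  have k: "1 \<le> k" "k - 1 + l' \<le> c" "j = a + k" "n = a + c" and a: "a = i - 1 + l + 0"
    and jr: "j - l + r = i - 1 + r + k"
    using i by (simp_all add: a_def c_def k_def)
  have kc: "c = k - 1 + l' + (c - (k - 1 + l'))" using k by simp
  show ?thesis
    using t[unfolded k(4)]
  proof (rule \<phi>.lin_eq_on_prods)
    fix x y assume x: "x \<in> tensor_power s a" and y: "y \<in> tensor_power s c"
    have \<phi>x: "apply_at s l i \<phi> x \<in> tensor_power s (i - 1 + r)"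
      using \<phi>.apply_at_power[OF x a] by (simp only: add_0_right)
    have "apply_at s l' j \<psi> (tensor_prod s x y) = tensor_prod s x (apply_at s l' k \<psi> y)"
      unfolding k(3) by (rule \<psi>.apply_at_shift[OF x y k(1,2)])
    moreover have "apply_at s l i \<phi> (tensor_prod s x (apply_at s l' k \<psi> y)) =
        tensor_prod s (apply_at s l i \<phi> x) (apply_at s l' k \<psi> y)"
      by (rule \<phi>.apply_at_right[OF x \<psi>.apply_at_power[OF y kc]]) (simp only: a_def order_refl)
    moreover have "apply_at s l' (j - l + r) \<psi> (tensor_prod s (apply_at s l i \<phi> x) y) =
        tensor_prod s (apply_at s l i \<phi> x) (apply_at s l' k \<psi> y)"
      unfolding jr by (rule \<psi>.apply_at_shift[OF \<phi>x y k(1,2)])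
    moreover have "apply_at s l i \<phi> (tensor_prod s x y) = tensor_prod s (apply_at s l i \<phi> x) y"
      by (rule \<phi>.apply_at_right[OF x y]) (simp only: a_def order_refl)
    ultimately show "apply_at s l i \<phi> (apply_at s l' j \<psi> (tensor_prod s x y)) =
        apply_at s l' (j - l + r) \<psi> (apply_at s l i \<phi> (tensor_prod s x y))"
      by (simp only:)
  qed (intro \<phi>.lin_apply_at \<phi>.lin_id)+
qed

section \<open>The grading of the tensor algebra\<close>

context tensor_setting
begin

text \<open>A multilinear form can be cut off to lists of one length. Evaluation at the cut-off form
  extracts a homogeneous component, which is why the sum of the tensor powers is direct.\<close>

lemma power_component:
  assumes t: "t \<in> T k" and A: "multilinear s (*) A"
  shows "t (\<lambda>xs. if length xs = n then A xs else 0) = (if k = n then t A else 0)"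
  using t
proof (induction rule: power_induct)
  case (step c xs t)
  have "multilinear s (*) (\<lambda>xs. if length xs = n then A xs else 0)"
    using A vs unfolding multilinear_def
    by (auto simp: Vector_Spaces.linear_iff vector_space_field)
  then show ?case
    using step A by (simp add: tensor_scale_def tensor_of_def)
qed simp

lemma power_sum_zero:
  assumes "finite K" and x: "\<And>k. k \<in> K \<Longrightarrow> x k \<in> T (d k)" and d: "inj_on d K"
    and zero: "(\<Sum>k\<in>K. x k) = 0" and k: "k \<in> K"
  shows "x k = 0"
proof
  fix A
  show "x k A = 0 A"
  proof (cases "multilinear s (*) A")
    case True
    let ?A = "\<lambda>xs. if length xs = d k then A xs else 0"
    have "0 = (\<Sum>i\<in>K. x i) ?A" by (simp add: zero)
    also have "\<dots> = (\<Sum>i\<in>K. x i ?A)"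
      by (induction K rule: infinite_finite_induct) simp_all
    also have "\<dots> = (\<Sum>i\<in>K. if i = k then x k A else 0)"
      using d k power_component[OF x True] by (intro sum.cong) (auto simp: inj_on_def)
    also have "\<dots> = x k A" using assms(1) k by simp
    finally show ?thesis by simp
  next
    case False
    then show ?thesis using tensor_algebra_zero[OF power_algebra[OF x[OF k]]] by simp
  qed
qed

lemma graded_space_tensor_algebra:
  "graded_space tensor_scale (tensor_algebra s) (tensor_grading s)"
  unfolding graded_space_def
proof (intro conjI allI impI)
  show "vector_space tensor_scale" by (rule tensor.vector_space_axioms)
  show "tensor.subspace (tensor_grading s k)" for k
    by (simp add: tensor_grading_def tensor_power_def)
  show "tensor_algebra s = tensor.span (\<Union>k. tensor_grading s k)"
  proof
    have "range (tensor_of s) \<subseteq> (\<Union>k. tensor_grading s k)"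
    proof
      fix t assume "t \<in> range (tensor_of s)"
      then obtain xs where "t = tensor_of s xs" by blast
      then have "t \<in> tensor_grading s (int (length xs))" by (simp add: tensor_grading_def)
      then show "t \<in> (\<Union>k. tensor_grading s k)" by blast
    qed
    then show "tensor_algebra s \<subseteq> tensor.span (\<Union>k. tensor_grading s k)"
      unfolding tensor_algebra_def by (rule tensor.span_mono)
    have "(\<Union>k. tensor_grading s k) \<subseteq> tensor_algebra s"
      using power_algebra tensor_algebra_zero_mem by (auto simp: tensor_grading_def split: if_splits)
    then show "tensor.span (\<Union>k. tensor_grading s k) \<subseteq> tensor_algebra s"
      unfolding tensor_algebra_def by (rule tensor.span_minimal) (rule tensor.subspace_span)
  qed
  fix K :: "int set" and x
  assume *: "finite K \<and> (\<forall>k\<in>K. x k \<in> tensor_grading s k) \<and> (\<Sum>k\<in>K. x k) = 0"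
  have neg: "x k = 0" if "k \<in> K" "k < 0" for k
    using * that by (auto simp: tensor_grading_def)
  have nonneg: "x k \<in> T (nat k)" if "k \<in> K" "0 \<le> k" for k
    using * that by (force simp: tensor_grading_def)
  show "\<forall>k\<in>K. x k = 0"
  proof
    fix k assume k: "k \<in> K"
    have "(\<Sum>k\<in>{k \<in> K. 0 \<le> k}. x k) = (\<Sum>k\<in>K. x k)"
      using * neg by (intro sum.mono_neutral_left) (auto simp: not_le)
    then have "(\<Sum>k\<in>{k \<in> K. 0 \<le> k}. x k) = 0" using * by simp
    moreover have "x k = 0" if "(\<Sum>k\<in>{k \<in> K. 0 \<le> k}. x k) = 0" "0 \<le> k"
      using * k that(2) nonneg by (intro power_sum_zero[OF _ _ _ that(1), of nat]) (auto simp: inj_on_def)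
    ultimately show "x k = 0" using neg k by force
  qed
qed

lemma endo_of_degree_minus_one:
  assumes d: "lin UNIV d" and zero: "\<And>t. t \<in> T 0 \<Longrightarrow> d t = 0"
    and down: "\<And>n t. 1 \<le> n \<Longrightarrow> t \<in> T n \<Longrightarrow> d t \<in> T (n - 1)"
  shows "endo_of_degree tensor_scale (tensor_algebra s) (tensor_grading s) (- 1) d"
proof -
  have d0: "d 0 = 0" using d by (rule lin_zero) simp
  have "d t \<in> tensor_algebra s" if "t \<in> tensor_algebra s" for t
    using that
  proof (rule tensor_algebra_induct)
    show "d 0 \<in> tensor_algebra s" by (simp only: d0 tensor_algebra_zero_mem)
    fix c xs t assume "d t \<in> tensor_algebra s"
    moreover have "d (tensor_of s xs) \<in> tensor_algebra s"
      using zero[of "tensor_of s xs"] down[of "length xs" "tensor_of s xs"] tensor_algebra_zero_mem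
      by (cases xs) (auto intro: power_algebra)
    ultimately show "d (tensor_scale c (tensor_of s xs) + t) \<in> tensor_algebra s"
      using d by (simp only: linear_on_def UNIV_I simp_thms ball_UNIV tensor_algebra_add tensor_algebra_scale)
  qed
  moreover have "d ` tensor_grading s k \<subseteq> tensor_grading s (k + - 1)" for k
  proof (cases "k \<le> 0")
    case True
    then have "d t = 0" if "t \<in> tensor_grading s k" for t
      using that zero d0 by (cases "k = 0") (auto simp: tensor_grading_def)
    then show ?thesis using True by (auto simp: tensor_grading_def)
  next
    case False
    then have "nat (k + - 1) = nat k - 1" "1 \<le> nat k" by simp_all
    then show ?thesis using False down[of "nat k"] by (auto simp: tensor_grading_def)
  qed
  ultimately show ?thesis
    using d by (auto simp: endo_of_degree_def intro: lin_subset)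
qed

lemma lin_eq_zero_on_algebra:
  assumes F: "lin UNIV F" and zero: "\<And>n t. t \<in> T n \<Longrightarrow> F t = 0" and t: "t \<in> tensor_algebra s"
  shows "F t = 0"
  using t
proof (rule tensor_algebra_induct)
  show "F 0 = 0" using F by (rule lin_zero) simp
  fix c xs t assume "F t = 0"
  moreover have "F (tensor_of s xs) = 0" by (rule zero[of _ "length xs"]) simp
  ultimately show "F (tensor_scale c (tensor_of s xs) + t) = 0"
    using F by (simp add: linear_on_def)
qed

end

section \<open>Evaluating a linear form on one tensor factor\<close>

context tensor_setting
begin

abbreviation linear_form :: "('v \<Rightarrow> 'k) \<Rightarrow> bool"
  where "linear_form f \<equiv> Vector_Spaces.linear s (*) f"

abbreviation ev :: "('v \<Rightarrow> 'k) \<Rightarrow> nat \<Rightarrow> ('k, 'v) tensor \<Rightarrow> ('k, 'v) tensor"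
  where "ev f i \<equiv> apply_at s 1 i (form_map s f)"

lemma form_map_tensor_of:
  assumes "linear_form f"
  shows "form_map s f (tensor_of s [v]) = tensor_scale (f v) (tensor_of s [])"
proof -
  have "multilinear s tensor_scale
    (\<lambda>xs. if length xs = 1 then tensor_scale (f (hd xs)) (tensor_of s []) else 0)"
    unfolding multilinear_def
  proof (intro allI)
    fix us ws :: "'v list"
    show "Vector_Spaces.linear s tensor_scale (\<lambda>v. if length (us @ v # ws) = 1
        then tensor_scale (f (hd (us @ v # ws))) (tensor_of s []) else 0)"
      using assms vs tensor.vector_space_axioms
      by (cases "us = [] \<and> ws = []")
        (auto simp: Vector_Spaces.linear_iff tensor.scale_left_distrib)
  qed
  from tensor_lift_tensor_of[OF this, of "[v]"] show ?thesis
    by (simp add: form_map_def)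
qed

lemma tensor_map_form:
  assumes "linear_form f"
  shows "tensor_map s (form_map s f) 1 0"
proof
  show lin: "lin (T 1) (form_map s f)"
    unfolding form_map_def by (rule linear_on_tensor_lift)
  show "form_map s f t \<in> T 0" if "t \<in> T 1" for t
    using that lin
  proof (rule lin_into_power)
    show "form_map s f (tensor_of s xs) \<in> T 0" if "length xs = 1" for xs
      using that form_map_tensor_of[OF assms, of "hd xs"] by (cases xs) (simp_all add: power_scale)
  qed
qed

lemma form_tensor_tensor_of:
  assumes "linear_form f" "linear_form g"
  shows "form_tensor f g (tensor_of s [v, w]) = f v * g w"
proof -
  have "multilinear s (*) (\<lambda>xs. if length xs = 2 then f (xs ! 0) * g (xs ! 1) else 0)"
    unfolding multilinear_def
  proof (intro allI)
    fix us ws :: "'v list"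
    consider "length (us @ ws) \<noteq> 1" | u where "us = [u]" "ws = []" | w where "us = []" "ws = [w]"
      by (cases us; cases ws) auto
    then show "Vector_Spaces.linear s (*) (\<lambda>v. if length (us @ v # ws) = 2
        then f ((us @ v # ws) ! 0) * g ((us @ v # ws) ! 1) else 0)"
      using assms by cases (auto simp: Vector_Spaces.linear_iff algebra_simps)
  qed
  then show ?thesis by (simp add: form_tensor_def tensor_of_def)
qed

lemma lin_scale: "lin W F \<Longrightarrow> lin W (\<lambda>x. tensor_scale c (F x))"
  unfolding linear_on_def by (metis tensor.scale_right_distrib tensor.scale_left_commute)

lemma lin_form_tensor: "lin W (\<lambda>t. tensor_scale (form_tensor f g t) x)"
  by (simp add: linear_on_def form_tensor_def tensor_scale_def fun_eq_iff algebra_simps)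

text \<open>The form evaluated last acts on the second of the original factors, hence the exchanged order
  on the right-hand side.\<close>

lemma ev_ev_first:
  assumes f: "linear_form f" and g: "linear_form g" and t: "t \<in> T 2"
  shows "ev f 1 (ev g 1 t) = tensor_scale (form_tensor g f t) (tensor_of s [])"
  using t
proof (rule lin_eq_on_power)
  interpret f: tensor_map s "form_map s f" 1 0 by (rule tensor_map_form[OF f])
  interpret g: tensor_map s "form_map s g" 1 0 by (rule tensor_map_form[OF g])
  fix xs :: "'v list" assume "length xs = 2"
  then obtain v w where xs: "xs = [v, w]" by (auto simp: length_Suc_conv numeral_2_eq_2)
  have "ev g 1 (tensor_of s [v, w]) = tensor_scale (g v) (tensor_of s [w])"
    using g.apply_at_decomposed[of "[]" 1 "[v]" "[w]"] unit_prod[of "tensor_of s [w]" 1]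
      tensor_prod_left_linear[of s "tensor_of s [w]"]
      unit_prod[OF power_scale[of "tensor_of s [w]" 1]]
    by (simp add: form_map_tensor_of[OF g] Vector_Spaces.linear_iff)
  moreover have "ev f 1 (tensor_of s [w]) = tensor_scale (f w) (tensor_of s [])"
    using f.apply_at_self[of "tensor_of s [w]"] by (simp add: form_map_tensor_of[OF f])
  ultimately show "ev f 1 (ev g 1 (tensor_of s xs)) =
      tensor_scale (form_tensor g f (tensor_of s xs)) (tensor_of s [])"
    by (simp add: xs apply_at_scale form_tensor_tensor_of[OF g f])
qed (intro lin_apply_at lin_id lin_form_tensor)+

lemma ev_commute:
  assumes f: "linear_form f" and g: "linear_form g" and t: "t \<in> T n" and n: "2 \<le> n"
  shows "ev g (n - 1) (ev f 1 t) = ev f 1 (ev g n t)"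
  using apply_at_commute[OF tensor_map_form[OF f] tensor_map_form[OF g] t, of 1 n] n by simp

lemma ev_ev_last:
  assumes f: "linear_form f" and g: "linear_form g" and t: "t \<in> T 2"
  shows "ev f 1 (ev g 2 t) = tensor_scale (form_tensor f g t) (tensor_of s [])"
  using ev_commute[OF f g t] ev_ev_first[OF g f t] by simp

lemma ev_power:
  assumes "linear_form f" "t \<in> T n" "1 \<le> i" "i \<le> n"
  shows "ev f i t \<in> T (n - 1)"
  using tensor_map.apply_at_power[OF tensor_map_form[OF assms(1)] assms(2), of i "n - i"] assms(3,4)
  by simp

end

section \<open>The braid operators on a tensor power\<close>

lemma (in tensor_map) apply_at_endo:
  assumes "l = r" "t \<in> T n" "1 \<le> i" "i - 1 + l \<le> n"
  shows "apply_at s l i \<phi> t \<in> T n"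
  using apply_at_power[OF assms(2), of i "n - (i - 1 + l)"] assms by simp

text \<open>The relation holds on the three factors that the operators touch, and the untouched factors are
  split off on both sides.\<close>

lemma (in tensor_map) apply_at_yang_baxter:
  assumes l: "l = 2" "r = 2"
    and yb: "\<And>t. t \<in> T 3 \<Longrightarrow>
      apply_at s 2 1 \<phi> (apply_at s 2 2 \<phi> (apply_at s 2 1 \<phi> t)) =
      apply_at s 2 2 \<phi> (apply_at s 2 1 \<phi> (apply_at s 2 2 \<phi> t))"
    and t: "t \<in> T n" and i: "1 \<le> i" "i + 1 < n"
  shows "apply_at s 2 i \<phi> (apply_at s 2 (i + 1) \<phi> (apply_at s 2 i \<phi> t)) =
    apply_at s 2 (i + 1) \<phi> (apply_at s 2 i \<phi> (apply_at s 2 (i + 1) \<phi> t))"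
proof -
  let ?S = "\<lambda>i. apply_at s 2 i \<phi>"
  have S: "?S j t \<in> T m" if "t \<in> T m" "1 \<le> j" "j + 1 \<le> m" for j m t
    using apply_at_endo[OF _ that(1), of j] that l by simp
  have left: "?S i (?S (i + 1) (?S i u)) = ?S (i + 1) (?S i (?S (i + 1) u))"
    if "u \<in> T ((i - 1) + 3)" for u
    using that
  proof (rule lin_eq_on_prods)
    fix x y assume x: "x \<in> T (i - 1)" and y: "y \<in> T 3"
    have S12: "?S 1 y \<in> T 3" "?S 2 y \<in> T 3" if "y \<in> T 3" for y
      using that by (simp_all add: S)
    have sh: "?S i (x \<odot> y) = x \<odot> ?S 1 y" "?S (i + 1) (x \<odot> y) = x \<odot> ?S 2 y" if "y \<in> T 3" for y
      using apply_at_shift[OF x that, of 1] apply_at_shift[OF x that, of 2] i l by simp_all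
    show "?S i (?S (i + 1) (?S i (x \<odot> y))) = ?S (i + 1) (?S i (?S (i + 1) (x \<odot> y)))"
      using y yb[OF y] S12 by (simp only: sh)
  qed (intro lin_apply_at lin_id)+
  have n: "((i - 1) + 3) + (n - (i + 2)) = n"
    using i by simp
  have "t \<in> T (((i - 1) + 3) + (n - (i + 2)))"
    unfolding n by (rule t)
  then show ?thesis
  proof (rule lin_eq_on_prods)
    fix u z assume u: "u \<in> T ((i - 1) + 3)" and z: "z \<in> T (n - (i + 2))"
    have sh: "?S j (u \<odot> z) = ?S j u \<odot> z" "?S j u \<in> T ((i - 1) + 3)"
      if "u \<in> T ((i - 1) + 3)" "j = i \<or> j = i + 1" for u j
    proof -
      have "j - 1 + l \<le> (i - 1) + 3" "1 \<le> j" "j + 1 \<le> (i - 1) + 3"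
        using that(2) i l by auto
      then show "?S j (u \<odot> z) = ?S j u \<odot> z" "?S j u \<in> T ((i - 1) + 3)"
        using apply_at_right[OF that(1) z, of j] S[OF that(1), of j] l by (simp_all only:)
    qed
    show "?S i (?S (i + 1) (?S i (u \<odot> z))) = ?S (i + 1) (?S i (?S (i + 1) (u \<odot> z)))"
      using u left[OF u] by (simp only: sh simp_thms)
  qed (intro lin_apply_at lin_id)+
qed

lemma (in tensor_map) apply_at_scaled_map:
  assumes "t \<in> T m" "i - 1 + l \<le> m"
  shows "apply_at s l i (\<lambda>x. tensor_scale c (\<phi> x)) t = tensor_scale c (apply_at s l i \<phi> t)"
proof -
  interpret c: tensor_map s "\<lambda>x. tensor_scale c (\<phi> x)" l r
    by unfold_locales (auto intro: lin_scale lin_\<phi> power_scale \<phi>_power)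
  show ?thesis
    using assms(1)
  proof (rule lin_eq_on_power)
    show "lin (T m) (apply_at s l i (\<lambda>x. tensor_scale c (\<phi> x)))"
      by (rule lin_apply_at[OF lin_id])
    show "lin (T m) (\<lambda>t. tensor_scale c (apply_at s l i \<phi> t))"
      by (intro lin_scale lin_apply_at lin_id)
    fix xs :: "'v list" assume len: "length xs = m"
    then have "length xs = i - 1 + l + (m - (i - 1 + l))"
      using assms(2) by simp
    then obtain us ys ws where xs: "xs = us @ ys @ ws"
      and len: "length us = i - 1" "length ys = l"
      using split_three by metis
    have mem: "\<phi> (tensor_of s ys) \<odot> tensor_of s ws \<in> tensor_algebra s"
      using prod_power[OF \<phi>_power, of "tensor_of s ys" "tensor_of s ws" "length ws"] len
      by (simp add: power_algebra)
    show "apply_at s l i (\<lambda>x. tensor_scale c (\<phi> x)) (tensor_of s xs) =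
        tensor_scale c (apply_at s l i \<phi> (tensor_of s xs))"
      using mem tensor_prod_left_linear[of s "tensor_of s ws"]
        tensor_prod_right_linear[OF vs, of "tensor_of s us"]
      by (simp add: xs apply_at_decomposed[OF len] c.apply_at_decomposed[OF len]
          Vector_Spaces.linear_iff linear_on_def)
  qed
qed

locale pre_braided_space = tensor_setting s
  for s :: "'k::field \<Rightarrow> 'v::ab_group_add \<Rightarrow> 'v" +
  fixes \<sigma> :: "('k, 'v) tensor \<Rightarrow> ('k, 'v) tensor"
  assumes pre: "pre_braiding s \<sigma>"
begin

text \<open>Written with a scalar so that linearity lemmas apply.\<close>

definition neg_braiding :: "('k, 'v) tensor \<Rightarrow> ('k, 'v) tensor"
  where "neg_braiding = (\<lambda>x. tensor_scale (- 1) (\<sigma> x))"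

abbreviation B :: "nat \<Rightarrow> ('k, 'v) tensor \<Rightarrow> ('k, 'v) tensor"
  where "B i \<equiv> apply_at s 2 i neg_braiding"

lemma neg_braiding_eq: "(\<lambda>x. - \<sigma> x) = neg_braiding"
  by (simp add: neg_braiding_def)

sublocale sigma: tensor_map s \<sigma> 2 2
  using pre by unfold_locales (auto simp: pre_braiding_def)

sublocale neg: tensor_map s neg_braiding 2 2
proof
  show "lin (T 2) neg_braiding"
    unfolding neg_braiding_def by (rule lin_scale[OF sigma.lin_\<phi>])
  show "neg_braiding t \<in> T 2" if "t \<in> T 2" for t
    unfolding neg_braiding_def by (rule power_scale[OF sigma.\<phi>_power[OF that]])
qed

lemma B_power: "t \<in> T n \<Longrightarrow> 1 \<le> i \<Longrightarrow> i < n \<Longrightarrow> B i t \<in> T n"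
  by (rule neg.apply_at_endo) simp_all

lemma braid_relations_B: "braid_relations (T n) n B"
proof
  show "B i (x + y) = B i x + B i y" for i x y by (rule apply_at_add)
  show "x \<in> T n \<Longrightarrow> 1 \<le> i \<Longrightarrow> i < n \<Longrightarrow> B i x \<in> T n" for i x by (rule B_power)
  show "x \<in> T n \<Longrightarrow> 1 \<le> i \<Longrightarrow> i + 1 < j \<Longrightarrow> j < n \<Longrightarrow> B i (B j x) = B j (B i x)" for i j x
    using apply_at_commute[OF neg.tensor_map_axioms neg.tensor_map_axioms, of x n i j]
      le_add_diff_inverse2[of 2 j] by (simp del: add_2_eq_Suc')
  let ?S = "\<lambda>i. apply_at s 2 i \<sigma>"
  have yb: "?S 1 (?S 2 (?S 1 t)) = ?S 2 (?S 1 (?S 2 t))" if "t \<in> T 3" for t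
    using pre that by (auto simp: pre_braiding_def)
  have neg: "B 1 t = tensor_scale (- 1) (?S 1 t)" "B 2 t = tensor_scale (- 1) (?S 2 t)"
    if "t \<in> T 3" for t
    unfolding neg_braiding_def by (rule sigma.apply_at_scaled_map[OF that]; simp)+
  have S: "?S 1 t \<in> T 3" "?S 2 t \<in> T 3" if "t \<in> T 3" for t
    by (rule sigma.apply_at_endo[OF refl that]; simp)+
  have yb_neg: "B 1 (B 2 (B 1 t)) = B 2 (B 1 (B 2 t))" if "t \<in> T 3" for t
    by (simp only: that neg S apply_at_scale yb[OF that])
  show "x \<in> T n \<Longrightarrow> 1 \<le> i \<Longrightarrow> i + 1 < n \<Longrightarrow>
      B i (B (i + 1) (B i x)) = B (i + 1) (B i (B (i + 1) x))" for i x
    by (rule neg.apply_at_yang_baxter[OF refl refl yb_neg])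
qed

text \<open>The sign comes from \<open>-\<sigma>\<close>. This and its mirror image are the places where the interaction
  of the forms with \<open>\<sigma>\<close> enters.\<close>

lemma ev_first_B:
  assumes f: "linear_form f" and g: "linear_form g" and t: "t \<in> T n" and n: "2 \<le> n"
    and fg: "\<And>y. y \<in> T 2 \<Longrightarrow> form_tensor g f (\<sigma> y) = form_tensor f g y"
  shows "ev f 1 (ev g 1 (B 1 t)) = - ev g 1 (ev f 1 t)"
proof -
  interpret f: tensor_map s "form_map s f" 1 0 by (rule tensor_map_form[OF f])
  interpret g: tensor_map s "form_map s g" 1 0 by (rule tensor_map_form[OF g])
  have "t \<in> T (2 + (n - 2))" using t n by (simp only: le_add_diff_inverse)
  then have "ev f 1 (ev g 1 (B 1 t)) = tensor_scale (- 1) (ev g 1 (ev f 1 t))"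
  proof (rule lin_eq_on_prods)
    fix y z assume y: "y \<in> T 2" and z: "z \<in> T (n - 2)"
    have ev: "ev h 1 (ev k 1 (y \<odot> z)) = ev h 1 (ev k 1 y) \<odot> z"
      if "linear_form h" "linear_form k" "y \<in> T 2" for h k y
    proof -
      have "ev k 1 (y \<odot> z) = ev k 1 y \<odot> z"
        by (rule tensor_map.apply_at_right[OF tensor_map_form[OF that(2)] that(3) z]) simp
      moreover have "ev h 1 (ev k 1 y \<odot> z) = ev h 1 (ev k 1 y) \<odot> z"
        by (rule tensor_map.apply_at_right[OF tensor_map_form[OF that(1)]
              ev_power[OF that(2,3)] z]) simp_all
      ultimately show ?thesis by (simp only:)
    qed
    have By: "B 1 (y \<odot> z) = B 1 y \<odot> z" "B 1 y = tensor_scale (- 1) (\<sigma> y)"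
      using neg.apply_at_right[OF y z, of 1] neg.apply_at_self[OF y] neg_braiding_def by simp_all
    have "ev f 1 (ev g 1 (B 1 y)) = tensor_scale (- 1) (ev g 1 (ev f 1 y))"
      using ev_ev_first[OF f g sigma.\<phi>_power[OF y]] ev_ev_first[OF g f y] fg[OF y]
      by (simp only: By apply_at_scale)
    moreover have "B 1 y \<in> T 2"
      using B_power[OF y, of 1] by simp
    moreover have "tensor_scale (- 1) w \<odot> z = tensor_scale (- 1) (w \<odot> z)" for w
      using tensor_prod_left_linear[of s z] unfolding Vector_Spaces.linear_iff by blast
    ultimately show "ev f 1 (ev g 1 (B 1 (y \<odot> z))) = tensor_scale (- 1) (ev g 1 (ev f 1 (y \<odot> z)))"
      using f g y by (simp only: By(1) ev)
  qed (intro lin_scale lin_apply_at lin_id)+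
  then show ?thesis by simp
qed

lemma ev_last_B:
  assumes f: "linear_form f" and g: "linear_form g" and t: "t \<in> T n" and n: "2 \<le> n"
    and fg: "\<And>y. y \<in> T 2 \<Longrightarrow> form_tensor f g (\<sigma> y) = form_tensor g f y"
  shows "ev f (n - 1) (ev g n (B (n - 1) t)) = - ev g (n - 1) (ev f n t)"
proof -
  have "t \<in> T ((n - 2) + 2)" using t n by (simp only: le_add_diff_inverse2)
  then have "ev f (n - 1) (ev g n (B (n - 1) t)) = tensor_scale (- 1) (ev g (n - 1) (ev f n t))"
  proof (rule lin_eq_on_prods)
    fix x y assume x: "x \<in> T (n - 2)" and y: "y \<in> T 2"
    have nn: "n - 2 + 2 = n" "n - 2 + 1 = n - 1" using n by simp_all
    have ev: "ev h (n - 1) (ev k n (x \<odot> y)) = x \<odot> ev h 1 (ev k 2 y)"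
      if "linear_form h" "linear_form k" "y \<in> T 2" for h k y
    proof -
      have "ev k (n - 2 + 2) (x \<odot> y) = x \<odot> ev k 2 y"
        by (rule tensor_map.apply_at_shift[OF tensor_map_form[OF that(2)] x that(3)]) simp_all
      moreover have "ev h (n - 2 + 1) (x \<odot> ev k 2 y) = x \<odot> ev h 1 (ev k 2 y)"
        by (rule tensor_map.apply_at_shift[OF tensor_map_form[OF that(1)] x
              ev_power[OF that(2,3)]]) simp_all
      ultimately show ?thesis by (simp only: nn)
    qed
    have By: "B (n - 1) (x \<odot> y) = x \<odot> B 1 y" "B 1 y = tensor_scale (- 1) (\<sigma> y)"
      using neg.apply_at_shift[OF x y, of 1] neg.apply_at_self[OF y] neg_braiding_def by (simp_all only: nn)
    have e: "ev f 1 (ev g 2 (B 1 y)) = tensor_scale (- 1) (ev g 1 (ev f 2 y))"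
      using ev_ev_last[OF f g sigma.\<phi>_power[OF y]] ev_ev_last[OF g f y] fg[OF y]
      by (simp only: By apply_at_scale)
    have "ev g 1 (ev f 2 y) \<in> T 0"
      using ev_power[OF g ev_power[OF f y, of 2], of 1] by simp
    then have sc: "x \<odot> tensor_scale (- 1) (ev g 1 (ev f 2 y)) = tensor_scale (- 1) (x \<odot> ev g 1 (ev f 2 y))"
      using tensor_prod_right_linear[OF vs power_algebra[OF x]] power_algebra
      unfolding linear_on_def by blast
    have "B 1 y \<in> T 2"
      using B_power[OF y, of 1] by simp
    with sc show "ev f (n - 1) (ev g n (B (n - 1) (x \<odot> y))) =
        tensor_scale (- 1) (ev g (n - 1) (ev f n (x \<odot> y)))"
      using f g y by (simp only: By(1) ev e)
  qed (intro lin_scale lin_apply_at lin_id)+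
  then show ?thesis by simp
qed

lemma word_B_ev_first:
  assumes f: "linear_form f" and t: "t \<in> T n" and ks: "set ks \<subseteq> {1..<n - 1}"
  shows "word B ks (ev f 1 t) = ev f 1 (word B (map Suc ks) t)"
  using ks
proof (induction ks)
  case (Cons k ks)
  define u where "u = word B (map Suc ks) t"
  have "u \<in> T n" unfolding u_def using Cons.prems t
    by (intro braid_relations.word_closed[OF braid_relations_B]) (auto simp: subset_eq less_diff_conv)
  moreover have "1 \<le> k" "Suc (Suc k) \<le> n" using Cons.prems by auto
  ultimately have "B k (ev f 1 u) = ev f 1 (B (Suc k) u)"
    using apply_at_commute[OF tensor_map_form[OF f] neg.tensor_map_axioms, of u n 1 "Suc k"]
    by simp
  then show ?case using Cons by (simp add: u_def)
qed simp

lemma word_B_ev_last: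
  assumes f: "linear_form f" and t: "t \<in> T n" and ks: "set ks \<subseteq> {1..<n - 1}"
  shows "word B ks (ev f n t) = ev f n (word B ks t)"
  using ks
proof (induction ks)
  case (Cons k ks)
  define u where "u = word B ks t"
  have "u \<in> T n" unfolding u_def using Cons.prems t
    by (intro braid_relations.word_closed[OF braid_relations_B]) (auto simp: subset_eq)
  then have "B k (ev f n u) = ev f n (B k u)"
    using apply_at_commute[OF neg.tensor_map_axioms tensor_map_form[OF f], of u n k n] Cons.prems
    by (auto simp del: add_2_eq_Suc')
  then show ?case using Cons by (simp add: u_def)
qed simp

end

section \<open>The left and right differentials\<close>

lemma additive_word: "(\<And>i. additive (f i)) \<Longrightarrow> additive (word f ks)"
  by (induction ks) (simp_all add: additive_def)

lemma map_diff_upt: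
  assumes "a \<le> c" "c \<le> Suc n"
  shows "map (\<lambda>i. n - i) [a..<c] = rev [Suc n - c..<Suc n - a]"
  using assms by (intro nth_equalityI) (auto simp: rev_nth)

context pre_braided_space
begin

lemma additive_ev: "additive (ev f i)"
  and additive_word_B: "additive (word B ks)"
proof -
  show ev: "additive (ev f i)" for f i by (simp add: additive_def apply_at_add)
  show "additive (word B ks)" by (rule additive_word) (simp add: additive_def apply_at_add)
qed

lemma word_B_scale: "word B ks (tensor_scale c x) = tensor_scale c (word B ks x)"
  by (induction ks) (simp_all only: word_Nil word_Cons apply_at_scale)

lemma word_B_power: "t \<in> T n \<Longrightarrow> set ks \<subseteq> {1..<n} \<Longrightarrow> word B ks t \<in> T n"
  by (rule braid_relations.word_closed[OF braid_relations_B])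

lemma left_diff_formula:
  assumes "t \<in> T n" "1 \<le> n"
  shows "left_diff s \<sigma> f t = ev f 1 (\<Sum>k = 1..n. word B [1..<k] t)"
proof -
  have n: "Suc (n - 1) = n" using assms(2) by simp
  show ?thesis
    using left_diff_eq[OF vs assms(2,1), of \<sigma> f]
    by (simp only: left_diff_comp_def neg_braiding_eq coshuffle_left n)
qed

lemma right_diff_formula:
  assumes "t \<in> T n" "1 \<le> n"
  shows "right_diff s \<sigma> f t =
    tensor_scale ((- 1) ^ (n - 1)) (ev f n (\<Sum>k = 1..n. word B (rev [k..<n]) t))"
proof -
  have n: "Suc (n - 1) = n" using assms(2) by simp
  show ?thesis
    using right_diff_eq[OF vs assms(2,1), of \<sigma> f]
    by (simp only: right_diff_comp_def neg_braiding_eq coshuffle_right n)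
qed

lemma left_sum_power: "t \<in> T n \<Longrightarrow> (\<Sum>k = 1..n. word B [1..<k] t) \<in> T n"
  and right_sum_power: "t \<in> T n \<Longrightarrow> (\<Sum>k = 1..n. word B (rev [k..<n]) t) \<in> T n"
  by (auto intro!: power_sum word_B_power)

lemma left_diff_power:
  assumes "linear_form f" "t \<in> T n" "1 \<le> n"
  shows "left_diff s \<sigma> f t \<in> T (n - 1)"
  unfolding left_diff_formula[OF assms(2,3)]
  using assms by (intro ev_power left_sum_power) auto

lemma right_diff_power:
  assumes "linear_form f" "t \<in> T n" "1 \<le> n"
  shows "right_diff s \<sigma> f t \<in> T (n - 1)"
  unfolding right_diff_formula[OF assms(2,3)]
  using assms by (intro power_scale ev_power right_sum_power) auto

lemma diff_degree_zero:
  assumes "t \<in> T 0"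
  shows "left_diff s \<sigma> f t = 0" "right_diff s \<sigma> f t = 0"
proof -
  have "assemble s D t = 0" for D
    using assms
  proof (rule lin_eq_on_power)
    show "lin (T 0) (assemble s D)"
      unfolding assemble_def by (rule linear_on_tensor_lift)
    show "lin (T 0) (\<lambda>_. 0)" by (simp add: linear_on_def)
    show "assemble s D (tensor_of s xs) = 0" if "length xs = 0" for xs
      using that by (auto simp: assemble_def tensor_lift_def tensor_of_def fun_eq_iff)
  qed
  then show "left_diff s \<sigma> f t = 0" "right_diff s \<sigma> f t = 0"
    by (simp_all only: left_diff_def right_diff_def)
qed

text \<open>The right-hand side is antisymmetric in \<open>f\<close> and \<open>g\<close>, since \<open>half_sum\<close> does not involve the
  forms.\<close>

lemma left_left:
  assumes f: "linear_form f" and g: "linear_form g" and t: "t \<in> T n" and n: "2 \<le> n"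
    and fg: "\<And>y. y \<in> T 2 \<Longrightarrow> form_tensor g f (\<sigma> y) = form_tensor f g y"
  shows "left_diff s \<sigma> f (left_diff s \<sigma> g t) =
    (let x = braid_relations.half_sum n B t in ev f 1 (ev g 1 x) - ev g 1 (ev f 1 x))"
proof -
  interpret braid_relations "T n" n B by (rule braid_relations_B)
  let ?u = "\<Sum>k = 1..n. word B [1..<k] t"
  have u: "?u \<in> T n" by (rule left_sum_power[OF t])
  have "left_diff s \<sigma> f (left_diff s \<sigma> g t) = ev f 1 (\<Sum>j = 1..n - 1. word B [1..<j] (ev g 1 ?u))"
    using left_diff_formula[OF left_diff_power[OF g t]] left_diff_formula[OF t] n by simp
  also have "(\<Sum>j = 1..n - 1. word B [1..<j] (ev g 1 ?u)) = (\<Sum>j = 1..n - 1. ev g 1 (word B [2..<Suc j] ?u))"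
  proof (rule sum.cong[OF refl])
    fix j assume "j \<in> {1..n - 1}"
    then have "word B [1..<j] (ev g 1 ?u) = ev g 1 (word B (map Suc [1..<j]) ?u)"
      by (intro word_B_ev_first[OF g u]) auto
    then show "word B [1..<j] (ev g 1 ?u) = ev g 1 (word B [2..<Suc j] ?u)"
      by (simp only: map_Suc_upt Suc_1)
  qed
  also have "\<dots> = ev g 1 (\<Sum>j = 1..n - 1. \<Sum>k = 1..n. word B [2..<Suc j] (word B [1..<k] t))"
    by (simp only: additive.sum[OF additive_ev] additive.sum[OF additive_word_B])
  also have "\<dots> = ev g 1 (half_sum t + B 1 (half_sum t))"
    by (simp only: double_shuffle_factor[OF t])
  also have "ev f 1 \<dots> = ev f 1 (ev g 1 (half_sum t)) + ev f 1 (ev g 1 (B 1 (half_sum t)))"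
    by (simp only: apply_at_add)
  also have "ev f 1 (ev g 1 (B 1 (half_sum t))) = - ev g 1 (ev f 1 (half_sum t))"
    using f g _ n fg by (rule ev_first_B) (intro half_sum_closed power_zero power_add t)
  finally show ?thesis by (simp only: Let_def diff_conv_add_uminus)
qed

text \<open>As for the left maps, now with the mirrored operators. The sign does not depend on the order
  of \<open>f\<close> and \<open>g\<close>, so the expression is again antisymmetric.\<close>

lemma right_right:
  assumes f: "linear_form f" and g: "linear_form g" and t: "t \<in> T n" and n: "2 \<le> n"
    and fg: "\<And>y. y \<in> T 2 \<Longrightarrow> form_tensor f g (\<sigma> y) = form_tensor g f y"
  shows "right_diff s \<sigma> f (right_diff s \<sigma> g t) =
    (let x = braid_relations.half_sum n (\<lambda>i. B (n - i)) t
     in tensor_scale ((- 1) ^ (n - 2) * (- 1) ^ (n - 1)) (ev f (n - 1) (ev g n x) - ev g (n - 1) (ev f n x)))"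
proof -
  let ?b = "\<lambda>i. B (n - i)"
  interpret braid_relations "T n" n ?b
    by (rule braid_relations.mirror[OF braid_relations_B])
  let ?u = "\<Sum>k = 1..n. word B (rev [k..<n]) t"
  have u: "?u \<in> T n" by (rule right_sum_power[OF t])
  have mirror_word: "word ?b [a..<c] x = word B (rev [Suc n - c..<Suc n - a]) x"
    if "a \<le> c" "c \<le> Suc n" for a c x
    using word_map[of B "\<lambda>i. n - i" "[a..<c]" x] map_diff_upt[OF that] by simp
  have nn: "n - 1 - 1 = n - 2" "1 \<le> n - 1" "1 \<le> n" using n by auto
  have "right_diff s \<sigma> f (right_diff s \<sigma> g t) =
      tensor_scale ((- 1) ^ (n - 2)) (ev f (n - 1) (\<Sum>j = 1..n - 1.
        word B (rev [j..<n - 1]) (tensor_scale ((- 1) ^ (n - 1)) (ev g n ?u))))"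
    using right_diff_formula[OF right_diff_power[OF g t nn(3)] nn(2)]
    by (simp only: nn(1) right_diff_formula[OF t nn(3)])
  also have "(\<Sum>j = 1..n - 1. word B (rev [j..<n - 1]) (tensor_scale ((- 1) ^ (n - 1)) (ev g n ?u))) =
      tensor_scale ((- 1) ^ (n - 1)) (\<Sum>j = 1..n - 1. word B (rev [j..<n - 1]) (ev g n ?u))"
    by (simp only: word_B_scale tensor.scale_sum_right)
  also have "(\<Sum>j = 1..n - 1. word B (rev [j..<n - 1]) (ev g n ?u)) =
      (\<Sum>j = 1..n - 1. ev g n (word B (rev [j..<n - 1]) ?u))"
    by (intro sum.cong refl word_B_ev_last[OF g u]) auto
  also have "\<dots> = ev g n (\<Sum>j = 1..n - 1. \<Sum>k = 1..n. word B (rev [j..<n - 1]) (word B (rev [k..<n]) t))"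
    by (simp only: additive.sum[OF additive_ev] additive.sum[OF additive_word_B])
  also have "(\<Sum>j = 1..n - 1. \<Sum>k = 1..n. word B (rev [j..<n - 1]) (word B (rev [k..<n]) t)) =
      (\<Sum>j = 1..n - 1. \<Sum>k = 1..n. word ?b [2..<Suc j] (word ?b [1..<k] t))"
    \<comment> \<open>both summations are reversed: the longer an ascending word, the smaller the last letter of its mirror image\<close>
    by (subst (1 2) sum.atLeastAtMost_rev) (auto intro!: sum.cong simp: mirror_word simp del: upt_Suc)
  also have "\<dots> = half_sum t + B (n - 1) (half_sum t)"
    by (rule double_shuffle_factor[OF t])
  also have "ev f (n - 1) (tensor_scale ((- 1) ^ (n - 1)) (ev g n \<dots>)) =
      tensor_scale ((- 1) ^ (n - 1))
        (ev f (n - 1) (ev g n (half_sum t)) + ev f (n - 1) (ev g n (B (n - 1) (half_sum t))))"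
    by (simp only: apply_at_add apply_at_scale)
  also have "ev f (n - 1) (ev g n (B (n - 1) (half_sum t))) = - ev g (n - 1) (ev f n (half_sum t))"
    using f g _ n fg by (rule ev_last_B) (intro half_sum_closed power_zero power_add t)
  finally show ?thesis by (simp only: Let_def diff_conv_add_uminus tensor.scale_scale)
qed

text \<open>Both composites are \<open>f\<close> on the first and \<open>g\<close> on the last factor of \<open>?x\<close>, and their signs are
  opposite.\<close>

lemma left_right_anticommute:
  assumes f: "linear_form f" and g: "linear_form g" and t: "t \<in> T n" and n: "2 \<le> n"
  shows "left_diff s \<sigma> f (right_diff s \<sigma> g t) + right_diff s \<sigma> g (left_diff s \<sigma> f t) = 0"
proof -
  interpret braid_relations "T n" n B by (rule braid_relations_B)
  let ?l = "\<Sum>j = 1..n. word B [1..<j] t" and ?r = "\<Sum>k = 1..n. word B (rev [k..<n]) t"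
  let ?x = "\<Sum>j = 1..n - 1. \<Sum>k = 1..n. word B [1..<j] (word B (rev [k..<n]) t)"
  let ?c = "(- 1) ^ (n - 1) :: 'k"
  have l: "?l \<in> T n" and r: "?r \<in> T n" by (rule left_sum_power[OF t], rule right_sum_power[OF t])
  have nn: "n - 1 - 1 = n - 2" "1 \<le> n - 1" "1 \<le> n" using n by auto
  have x: "?x \<in> T n"
    using n t by (intro power_sum word_B_power) auto
  have "left_diff s \<sigma> f (right_diff s \<sigma> g t) =
      ev f 1 (\<Sum>j = 1..n - 1. word B [1..<j] (tensor_scale ?c (ev g n ?r)))"
    using left_diff_formula[OF right_diff_power[OF g t nn(3)] nn(2)]
    by (simp only: right_diff_formula[OF t nn(3)])
  also have "\<dots> = tensor_scale ?c (ev f 1 (\<Sum>j = 1..n - 1. word B [1..<j] (ev g n ?r)))"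
    by (simp only: word_B_scale tensor.scale_sum_right[symmetric] apply_at_scale)
  also have "(\<Sum>j = 1..n - 1. word B [1..<j] (ev g n ?r)) = (\<Sum>j = 1..n - 1. ev g n (word B [1..<j] ?r))"
    by (intro sum.cong refl word_B_ev_last[OF g r]) auto
  also have "\<dots> = ev g n ?x"
    by (simp only: additive.sum[OF additive_ev] additive.sum[OF additive_word_B])
  finally have LR: "left_diff s \<sigma> f (right_diff s \<sigma> g t) = tensor_scale ?c (ev f 1 (ev g n ?x))" .
  have "right_diff s \<sigma> g (left_diff s \<sigma> f t) = tensor_scale ((- 1) ^ (n - 2))
      (ev g (n - 1) (\<Sum>k = 1..n - 1. word B (rev [k..<n - 1]) (ev f 1 ?l)))"
    using right_diff_formula[OF left_diff_power[OF f t nn(3)] nn(2)]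
    by (simp only: nn(1) left_diff_formula[OF t nn(3)])
  also have "(\<Sum>k = 1..n - 1. word B (rev [k..<n - 1]) (ev f 1 ?l)) =
      (\<Sum>k = 1..n - 1. ev f 1 (word B (rev [Suc k..<n]) ?l))"
  proof (rule sum.cong[OF refl])
    fix k assume "k \<in> {1..n - 1}"
    then have "word B (rev [k..<n - 1]) (ev f 1 ?l) = ev f 1 (word B (map Suc (rev [k..<n - 1])) ?l)"
      by (intro word_B_ev_first[OF f l]) auto
    moreover have "Suc (n - 1) = n" using n by simp
    ultimately show "word B (rev [k..<n - 1]) (ev f 1 ?l) = ev f 1 (word B (rev [Suc k..<n]) ?l)"
      by (simp only: rev_map[symmetric] map_Suc_upt)
  qed
  also have "\<dots> = ev f 1 (\<Sum>k = 1..n - 1. \<Sum>j = 1..n. word B (rev [Suc k..<n]) (word B [1..<j] t))"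
    by (simp only: additive.sum[OF additive_ev] additive.sum[OF additive_word_B])
  also have "\<dots> = ev f 1 ?x"
    by (simp only: coshuffle_coassoc[OF t])
  also have "ev g (n - 1) (ev f 1 ?x) = ev f 1 (ev g n ?x)"
    by (rule ev_commute[OF f g x n])
  finally have RL: "right_diff s \<sigma> g (left_diff s \<sigma> f t) =
      tensor_scale ((- 1) ^ (n - 2)) (ev f 1 (ev g n ?x))" .
  obtain m where m: "n = Suc (Suc m)" using n by (metis Suc_le_D numeral_2_eq_2 Suc_le_mono)
  have "?c = - ((- 1) ^ (n - 2))" by (simp add: m)
  then show ?thesis by (simp only: LR RL tensor.scale_minus_left ab_left_minus)
qed

text \<open>Here the composite passes through degree zero or below, so the formulas above, which need two
  factors, are replaced by a degree argument.\<close>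

lemma low_degrees:
  assumes t: "t \<in> T n" and n: "\<not> 2 \<le> n" and g: "linear_form g"
  shows "left_diff s \<sigma> f (left_diff s \<sigma> g t) = 0" "left_diff s \<sigma> f (right_diff s \<sigma> g t) = 0"
    "right_diff s \<sigma> f (left_diff s \<sigma> g t) = 0" "right_diff s \<sigma> f (right_diff s \<sigma> g t) = 0"
proof -
  have "left_diff s \<sigma> g t \<in> T 0 \<and> right_diff s \<sigma> g t \<in> T 0"
  proof (cases "n = 0")
    case True
    then show ?thesis using t diff_degree_zero[of t g] power_zero by simp
  next
    case False
    then have "n = 1" using n by linarith
    then show ?thesis using left_diff_power[OF g t] right_diff_power[OF g t] by simp
  qed
  then show "left_diff s \<sigma> f (left_diff s \<sigma> g t) = 0" "left_diff s \<sigma> f (right_diff s \<sigma> g t) = 0"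
    "right_diff s \<sigma> f (left_diff s \<sigma> g t) = 0" "right_diff s \<sigma> f (right_diff s \<sigma> g t) = 0"
    by (auto intro: diff_degree_zero)
qed

lemma lin_diff: "lin UNIV (left_diff s \<sigma> f)" "lin UNIV (right_diff s \<sigma> f)"
  unfolding left_diff_def right_diff_def assemble_def by (rule linear_on_tensor_lift)+

lemma lin_diff_comp:
  assumes "lin UNIV d" "lin UNIV d'"
  shows "lin UNIV (\<lambda>t. d' (d t))"
  using assms by (simp add: linear_on_def)

lemma lin_add: "lin W F \<Longrightarrow> lin W G \<Longrightarrow> lin W (\<lambda>t. F t + G t)"
  by (simp add: linear_on_def tensor.scale_right_distrib)

lemma endo_diff:
  assumes "linear_form f"
  shows "endo_of_degree tensor_scale (tensor_algebra s) (tensor_grading s) (- 1) (left_diff s \<sigma> f)"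
    "endo_of_degree tensor_scale (tensor_algebra s) (tensor_grading s) (- 1) (right_diff s \<sigma> f)"
  by (rule endo_of_degree_minus_one[OF lin_diff(1) diff_degree_zero(1) left_diff_power[OF assms]];
      assumption)
    (rule endo_of_degree_minus_one[OF lin_diff(2) diff_degree_zero(2) right_diff_power[OF assms]];
      assumption)

lemma left_left_compatible:
  assumes "compatible s \<sigma> f g" and t: "t \<in> tensor_algebra s"
  shows "left_diff s \<sigma> f (left_diff s \<sigma> g t) + left_diff s \<sigma> g (left_diff s \<sigma> f t) = 0"
proof (rule lin_eq_zero_on_algebra[OF lin_add[OF lin_diff_comp[OF lin_diff(1) lin_diff(1)]
        lin_diff_comp[OF lin_diff(1) lin_diff(1)]] _ t])
  have f: "linear_form f" and g: "linear_form g" using assms by (auto simp: compatible_def)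
  fix n t assume t: "t \<in> T n"
  show "left_diff s \<sigma> f (left_diff s \<sigma> g t) + left_diff s \<sigma> g (left_diff s \<sigma> f t) = 0"
  proof (cases "2 \<le> n")
    case True
    have fg: "form_tensor f g (\<sigma> y) = form_tensor g f y" and gf: "form_tensor g f (\<sigma> y) = form_tensor f g y"
      if "y \<in> T 2" for y
      using assms(1) that by (simp_all add: compatible_def)
    show ?thesis
      by (simp only: Let_def left_left[OF f g t True gf] left_left[OF g f t True fg]) (simp only: diff_add_eq_diff_diff_swap add_diff_eq diff_add_cancel diff_self)
next
    case False
    then show ?thesis
      by (simp only: low_degrees[OF t False f] low_degrees[OF t False g] add_0)
  qed
qed

lemma right_right_compatible:
  assumes "compatible s \<sigma> f g" and t: "t \<in> tensor_algebra s"
  shows "right_diff s \<sigma> f (right_diff s \<sigma> g t) + right_diff s \<sigma> g (right_diff s \<sigma> f t) = 0"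
proof (rule lin_eq_zero_on_algebra[OF lin_add[OF lin_diff_comp[OF lin_diff(2) lin_diff(2)]
        lin_diff_comp[OF lin_diff(2) lin_diff(2)]] _ t])
  have f: "linear_form f" and g: "linear_form g" using assms by (auto simp: compatible_def)
  fix n t assume t: "t \<in> T n"
  show "right_diff s \<sigma> f (right_diff s \<sigma> g t) + right_diff s \<sigma> g (right_diff s \<sigma> f t) = 0"
  proof (cases "2 \<le> n")
    case True
    have fg: "form_tensor f g (\<sigma> y) = form_tensor g f y" and gf: "form_tensor g f (\<sigma> y) = form_tensor f g y"
      if "y \<in> T 2" for y
      using assms(1) that by (simp_all add: compatible_def)
    show ?thesis
      by (simp only: Let_def right_right[OF f g t True fg] right_right[OF g f t True gf] tensor.scale_right_distrib[symmetric])
        (simp only: add_diff_eq diff_add_cancel diff_self tensor.scale_zero_right)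
next
    case False
    then show ?thesis
      by (simp only: low_degrees[OF t False f] low_degrees[OF t False g] add_0)
  qed
qed

lemma square_zero:
  assumes "braided_character s \<sigma> f" and t: "t \<in> tensor_algebra s"
  shows "left_diff s \<sigma> f (left_diff s \<sigma> f t) = 0" "right_diff s \<sigma> f (right_diff s \<sigma> f t) = 0"
proof -
  have f: "linear_form f" using assms by (auto simp: braided_character_def)
  have fg: "form_tensor f f (\<sigma> y) = form_tensor f f y" if "y \<in> T 2" for y
    using assms(1) that by (simp add: braided_character_def)
  have l: "left_diff s \<sigma> f (left_diff s \<sigma> f t) = 0" if "t \<in> T n" for n t
    using left_left[OF f f that _ fg] low_degrees(1)[OF that _ f]
    by (cases "2 \<le> n") (simp_all only: Let_def diff_self simp_thms)
  have r: "right_diff s \<sigma> f (right_diff s \<sigma> f t) = 0" if "t \<in> T n" for n t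
    using right_right[OF f f that _ fg] low_degrees(4)[OF that _ f]
    by (cases "2 \<le> n") (simp_all only: Let_def diff_self tensor.scale_zero_right simp_thms)
  show "left_diff s \<sigma> f (left_diff s \<sigma> f t) = 0"
    by (rule lin_eq_zero_on_algebra[OF lin_diff_comp[OF lin_diff(1) lin_diff(1)] l t])
  show "right_diff s \<sigma> f (right_diff s \<sigma> f t) = 0"
    by (rule lin_eq_zero_on_algebra[OF lin_diff_comp[OF lin_diff(2) lin_diff(2)] r t])
qed

lemma left_right_algebra:
  assumes f: "linear_form f" and g: "linear_form g" and t: "t \<in> tensor_algebra s"
  shows "left_diff s \<sigma> f (right_diff s \<sigma> g t) + right_diff s \<sigma> g (left_diff s \<sigma> f t) = 0"
proof (rule lin_eq_zero_on_algebra[OF lin_add[OF lin_diff_comp[OF lin_diff(2) lin_diff(1)]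
        lin_diff_comp[OF lin_diff(1) lin_diff(2)]] _ t])
  fix n t assume t: "t \<in> T n"
  show "left_diff s \<sigma> f (right_diff s \<sigma> g t) + right_diff s \<sigma> g (left_diff s \<sigma> f t) = 0"
  proof (cases "2 \<le> n")
    case True
    then show ?thesis by (rule left_right_anticommute[OF f g t])
  next
    case False
    then show ?thesis
      by (simp only: low_degrees[OF t False f] low_degrees[OF t False g] add_0)
  qed
qed

lemma differentials:
  assumes "braided_character s \<sigma> f"
  shows "differential tensor_scale (tensor_algebra s) (tensor_grading s) (left_diff s \<sigma> f)"
    "differential tensor_scale (tensor_algebra s) (tensor_grading s) (right_diff s \<sigma> f)"
  using assms endo_diff[of f] square_zero[OF assms]
  by (auto simp: differential_def braided_character_def)

end

theorem theorem2:
  fixes s :: "'k::field \<Rightarrow> 'v::ab_group_add \<Rightarrow> 'v"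
    and \<sigma> :: "('k, 'v) tensor \<Rightarrow> ('k, 'v) tensor"
  assumes "vector_space s" and "pre_braiding s \<sigma>"
  shows "(\<forall>\<epsilon>. braided_character s \<sigma> \<epsilon> \<longrightarrow>
      (\<forall>n\<ge>1. left_diff s \<sigma> \<epsilon> ` tensor_power s n \<subseteq> tensor_power s (n - 1) \<and>
             right_diff s \<sigma> \<epsilon> ` tensor_power s n \<subseteq> tensor_power s (n - 1)) \<and>
      bidifferential tensor_scale (tensor_algebra s) (tensor_grading s)
        (left_diff s \<sigma> \<epsilon>) (right_diff s \<sigma> \<epsilon>)) \<and>
    (\<forall>\<epsilon> \<zeta>. braided_character s \<sigma> \<epsilon> \<and> braided_character s \<sigma> \<zeta> \<longrightarrow>
      bicomplex tensor_scale (tensor_algebra s) (tensor_grading s)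
        (left_diff s \<sigma> \<epsilon>) (right_diff s \<sigma> \<zeta>) \<and>
      (compatible s \<sigma> \<epsilon> \<zeta> \<longrightarrow>
        bicomplex tensor_scale (tensor_algebra s) (tensor_grading s)
          (left_diff s \<sigma> \<epsilon>) (left_diff s \<sigma> \<zeta>) \<and>
        bicomplex tensor_scale (tensor_algebra s) (tensor_grading s)
          (right_diff s \<sigma> \<epsilon>) (right_diff s \<sigma> \<zeta>)))"
proof -
  interpret pre_braided_space s \<sigma>
    by (intro pre_braided_space.intro tensor_setting.intro pre_braided_space_axioms.intro assms)
  have form: "linear_form \<epsilon>" if "braided_character s \<sigma> \<epsilon>" for \<epsilon>
    using that by (simp add: braided_character_def)
  let ?bidifferential = "bidifferential tensor_scale (tensor_algebra s) (tensor_grading s)"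
  have left_right: "?bidifferential (left_diff s \<sigma> \<epsilon>) (right_diff s \<sigma> \<zeta>)"
    if "braided_character s \<sigma> \<epsilon>" "braided_character s \<sigma> \<zeta>" for \<epsilon> \<zeta>
    unfolding bidifferential_def using that
    by (intro conjI ballI differentials left_right_algebra form)
  have same_side: "?bidifferential (left_diff s \<sigma> \<epsilon>) (left_diff s \<sigma> \<zeta>)"
    "?bidifferential (right_diff s \<sigma> \<epsilon>) (right_diff s \<sigma> \<zeta>)"
    if "braided_character s \<sigma> \<epsilon>" "braided_character s \<sigma> \<zeta>" "compatible s \<sigma> \<epsilon> \<zeta>" for \<epsilon> \<zeta>
    unfolding bidifferential_def using that
    by (auto intro: differentials left_left_compatible right_right_compatible)
  have degree: "left_diff s \<sigma> \<epsilon> ` T n \<subseteq> T (n - 1)" "right_diff s \<sigma> \<epsilon> ` T n \<subseteq> T (n - 1)"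
    if "braided_character s \<sigma> \<epsilon>" "1 \<le> n" for \<epsilon> n
    using left_diff_power[OF form[OF that(1)] _ that(2)] right_diff_power[OF form[OF that(1)] _ that(2)]
    by blast+
  show ?thesis
    unfolding bicomplex_def using graded_space_tensor_algebra left_right same_side degree by blast
qed

end
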